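(* Let $p\in[3/2,+\infty)$ and let $X$ be any vector field in $L^p_{\mathbb{Z}}(B)$. Then $X$ is divergence free, i.e. $\mathrm{div}(X)=0$ in $\mathcal{D}'(B)$.
   Context: $B$ is the open unit ball in $\mathbb{R}^3$; $C=(-1/2,1/2)^3$ is the open unit cube centred at the origin, $C_r(x_0):=rC+x_0$, and $\nu_{\partial C_r(x_0)}$ is the outward unit normal to $\partial C_r(x_0)$. $L^p_{\mathbb{Z}}(B)$ (vector fields with integer valued fluxes) is the set of all $X\in L^p(B;\mathbb{R}^3)$ such that for every $x_0\in B$ one has $\int_{\partial C_r(x_0)}X\cdot\nu_{\partial C_r(x_0)}\,d\mathcal{H}^2\in\mathbb{Z}$ for $\mathcal{L}^1$-a.e. Lebesgue point $r$ of the function $X_{x_0}(r):=\int_{\partial C_r(x_0)}X\cdot\nu_{\partial C_r(x_0)}\,d\mathcal{H}^2$, $r\in\big(0,\frac{1}{\sqrt3}\mathrm{dist}(x_0,\partial B)\big)$ (which is well defined for a.e. $r$ by Fubini's theorem). *)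

theory Defs
  imports "HOL-Analysis.Analysis"
begin

section \<open>Hausdorff measure\<close>

text \<open>The Hausdorff measure of dimension \<open>s > 0\<close>, normalised so that for integer \<open>s\<close> it
  is the usual \<open>s\<close>-dimensional area: a covering set \<open>E\<close> of diameter \<open>d\<close> has the weight
  \<open>\<omega>\<^sub>s (d/2)\<^sup>s\<close>, where \<open>\<omega>\<^sub>s\<close> is the volume of the \<open>s\<close>-dimensional unit ball. (For \<open>s = 0\<close> the
  weight would be wrong, as \<open>0 powr 0 = 0\<close>.) Boundedness of the covering sets is required
  because \<^const>\<open>diameter\<close> is unspecified on unbounded sets.\<close>

definition hausdorff_weight :: "real \<Rightarrow> 'a::metric_space set \<Rightarrow> ennreal" where
  "hausdorff_weight s E = ennreal (unit_ball_vol s * (diameter E / 2) powr s)"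

definition hausdorff_covers :: "real \<Rightarrow> 'a::metric_space set \<Rightarrow> (nat \<Rightarrow> 'a set) set" where
  "hausdorff_covers \<delta> A = {E. A \<subseteq> (\<Union>i. E i) \<and> (\<forall>i. bounded (E i) \<and> diameter (E i) \<le> \<delta>)}"

definition hausdorff_pre :: "real \<Rightarrow> real \<Rightarrow> 'a::metric_space set \<Rightarrow> ennreal" where
  "hausdorff_pre s \<delta> A = (INF E\<in>hausdorff_covers \<delta> A. \<Sum>i. hausdorff_weight s (E i))"

definition hausdorff_outer :: "real \<Rightarrow> 'a::metric_space set \<Rightarrow> ennreal" where
  "hausdorff_outer s A = (SUP \<delta>\<in>{0<..}. hausdorff_pre s \<delta> A)"

text \<open>The (complete) measure on the sets that are measurable in the sense of Caratheodory.\<close>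

definition hausdorff_measure :: "real \<Rightarrow> 'a::metric_space measure" where
  "hausdorff_measure s =
     measure_of UNIV (lambda_system UNIV UNIV (hausdorff_outer s)) (hausdorff_outer s)"

lemma hausdorff_pre_empty: "0 < \<delta> \<Longrightarrow> hausdorff_pre s \<delta> {} = 0"
proof -
  assume "0 < \<delta>"
  then have "(\<lambda>_. {}) \<in> hausdorff_covers \<delta> ({} :: 'a set)"
    by (simp add: hausdorff_covers_def diameter_def)
  then have "hausdorff_pre s \<delta> ({} :: 'a set) \<le> (\<Sum>i::nat. hausdorff_weight s ({} :: 'a set))"
    unfolding hausdorff_pre_def by (rule INF_lower)
  then show ?thesis by (simp add: hausdorff_weight_def diameter_def)
qed

lemma hausdorff_pre_mono: "A \<subseteq> B \<Longrightarrow> hausdorff_pre s \<delta> A \<le> hausdorff_pre s \<delta> B"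
  unfolding hausdorff_pre_def hausdorff_covers_def by (rule INF_superset_mono) auto

lemma hausdorff_pre_UN:
  "hausdorff_pre s \<delta> (\<Union>i::nat. A i) \<le> (\<Sum>i. hausdorff_pre s \<delta> (A i))"
proof (rule ennreal_le_epsilon)
  fix e :: real
  assume fin: "(\<Sum>i. hausdorff_pre s \<delta> (A i)) < top" and e: "0 < e"
  have "\<exists>E\<in>hausdorff_covers \<delta> (A i).
      (\<Sum>j. hausdorff_weight s (E j)) < hausdorff_pre s \<delta> (A i) + ennreal (e * (1/2)^Suc i)" for i
  proof -
    have "hausdorff_pre s \<delta> (A i) < top"
      using fin by (meson ennreal_suminf_lessD)
    then have "hausdorff_pre s \<delta> (A i) < hausdorff_pre s \<delta> (A i) + ennreal (e * (1/2)^Suc i)"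
      using e by (auto simp: ennreal_zero_less_mult_iff less_top)
    then show ?thesis
      unfolding hausdorff_pre_def by (simp only: INF_less_iff)
  qed
  then obtain E where E: "\<And>i. E i \<in> hausdorff_covers \<delta> (A i)"
    and Ew: "\<And>i. (\<Sum>j. hausdorff_weight s (E i j))
                < hausdorff_pre s \<delta> (A i) + ennreal (e * (1/2)^Suc i)"
    by metis
  define F where "F n = (case prod_decode n of (i, j) \<Rightarrow> E i j)" for n
  have "(\<Union>i. A i) \<subseteq> (\<Union>n. F n)"
  proof
    fix x assume "x \<in> (\<Union>i. A i)"
    then obtain i j where "x \<in> E i j"
      using E unfolding hausdorff_covers_def by blast
    then have "x \<in> F (prod_encode (i, j))" by (simp add: F_def)
    then show "x \<in> (\<Union>n. F n)" by blast
  qed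
  then have "F \<in> hausdorff_covers \<delta> (\<Union>i. A i)"
    using E by (auto simp: hausdorff_covers_def F_def split: prod.split)
  then have "hausdorff_pre s \<delta> (\<Union>i. A i) \<le> (\<Sum>n. hausdorff_weight s (F n))"
    unfolding hausdorff_pre_def by (rule INF_lower)
  also have "\<dots> = (\<Sum>n. (\<lambda>(i, j). hausdorff_weight s (E i j)) (prod_decode n))"
    by (simp add: F_def split_beta)
  also have "\<dots> = (\<Sum>i. \<Sum>j. hausdorff_weight s (E i j))"
    by (rule suminf_ennreal_2dimen) simp
  also have "\<dots> \<le> (\<Sum>i. hausdorff_pre s \<delta> (A i) + ennreal (e * (1/2)^Suc i))"
    using Ew by (intro suminf_le) (auto intro: less_imp_le)
  also have "\<dots> = (\<Sum>i. hausdorff_pre s \<delta> (A i)) + (\<Sum>i. ennreal (e * (1/2)^Suc i))"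
    by (rule suminf_add[symmetric]) auto
  also have "(\<Sum>i. ennreal (e * (1/2)^Suc i)) = ennreal e"
    using sums_mult[OF power_half_series, of e] e
    by (subst suminf_ennreal_eq[where x = e]) auto
  finally show "hausdorff_pre s \<delta> (\<Union>i. A i) \<le> (\<Sum>i. hausdorff_pre s \<delta> (A i)) + ennreal e" .
qed

lemma outer_measure_space_hausdorff: "outer_measure_space UNIV (hausdorff_outer s)"
  unfolding outer_measure_space_def
proof (intro conjI)
  have "hausdorff_outer s {} \<le> 0"
    unfolding hausdorff_outer_def by (rule SUP_least) (simp add: hausdorff_pre_empty)
  then show "positive UNIV (hausdorff_outer s)"
    by (simp add: positive_def)
  show "increasing UNIV (hausdorff_outer s)"
    unfolding increasing_def hausdorff_outer_def
    by (auto intro: SUP_subset_mono hausdorff_pre_mono)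
  show "countably_subadditive UNIV (hausdorff_outer s)"
    unfolding countably_subadditive_def hausdorff_outer_def
    by (auto intro!: SUP_least order_trans[OF hausdorff_pre_UN] suminf_le SUP_upper)
qed

lemma measure_space_hausdorff:
  "measure_space UNIV (lambda_system UNIV UNIV (hausdorff_outer s)) (hausdorff_outer s)"
proof -
  have "sigma_algebra UNIV (UNIV :: 'a set set)"
    using sigma_algebra_Pow[of UNIV] by simp
  then show ?thesis
    using sigma_algebra.caratheodory_lemma outer_measure_space_hausdorff by blast
qed

lemma space_hausdorff_measure [simp]: "space (hausdorff_measure s) = UNIV"
  by (simp add: hausdorff_measure_def space_measure_of_conv)

lemma sets_hausdorff_measure:
  "sets (hausdorff_measure s) = lambda_system UNIV UNIV (hausdorff_outer s)"
  using measure_space_hausdorff[of s] unfolding hausdorff_measure_def measure_space_def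
  by (metis sigma_algebra.sets_measure_of_eq)

lemma emeasure_hausdorff_measure:
  assumes "A \<in> sets (hausdorff_measure s)"
  shows "emeasure (hausdorff_measure s) A = hausdorff_outer s A"
  using measure_space_hausdorff[of s] assms
  by (intro emeasure_measure_of[OF hausdorff_measure_def])
     (auto simp: sets_hausdorff_measure measure_space_def)


section \<open>Fluxes through cubes\<close>

definition unit_cube :: "(real^3) set" where
  "unit_cube = {x. \<forall>i. -1/2 < x $ i \<and> x $ i < 1/2}"

definition cube :: "real \<Rightarrow> real^3 \<Rightarrow> (real^3) set" where
  "cube r x0 = (\<lambda>x. r *\<^sub>R x + x0) ` unit_cube"

text \<open>The outward unit normal of a convex body \<open>S\<close> at \<open>y \<in> frontier S\<close>: the unit vector whose
  orthogonal hyperplane through \<open>y\<close> supports \<open>S\<close>. Where it is not unique (on the edges of a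
  cube, a null set for the surface measure) the value is unspecified.\<close>

definition outward_normal :: "'a::real_inner set \<Rightarrow> 'a \<Rightarrow> 'a" where
  "outward_normal S y = (THE v. norm v = 1 \<and> (\<forall>z\<in>S. (z - y) \<bullet> v \<le> 0))"

definition cube_flux :: "(real^3 \<Rightarrow> real^3) \<Rightarrow> real^3 \<Rightarrow> real \<Rightarrow> real" where
  "cube_flux X x0 r =
     (LINT y:frontier (cube r x0)|hausdorff_measure 2. X y \<bullet> outward_normal (cube r x0) y)"

definition lebesgue_point :: "(real \<Rightarrow> real) \<Rightarrow> real \<Rightarrow> bool" where
  "lebesgue_point f r \<longleftrightarrow>
     ((\<lambda>h. (\<integral>\<^sup>+ s\<in>{r - h..r + h}. ennreal \<bar>f s - f r\<bar> \<partial>lebesgue) / ennreal (2 * h)) \<longlongrightarrow> 0)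
       (at_right 0)"


section \<open>Vector fields with integer fluxes\<close>

definition Lp_fields :: "real \<Rightarrow> (real^3) set \<Rightarrow> (real^3 \<Rightarrow> real^3) set" where
  "Lp_fields p \<Omega> = {X \<in> borel_measurable (lebesgue_on \<Omega>).
     integrable (lebesgue_on \<Omega>) (\<lambda>x. norm (X x) powr p)}"

text \<open>The elements are functions, not classes modulo null sets. By Fubini's theorem the
  condition on the fluxes does not depend on the representative.\<close>

definition Lp_integer_fluxes :: "real \<Rightarrow> (real^3 \<Rightarrow> real^3) set" where
  "Lp_integer_fluxes p = {X \<in> Lp_fields p (ball 0 1).
     \<forall>x0\<in>ball 0 1. AE r in lebesgue.
       r \<in> {0<..<infdist x0 (frontier (ball 0 1)) / sqrt 3} \<longrightarrow>
       lebesgue_point (cube_flux X x0) r \<longrightarrow> cube_flux X x0 r \<in> \<int>}"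


section \<open>Distributional divergence\<close>

primrec C_k :: "nat \<Rightarrow> ('a::euclidean_space \<Rightarrow> real) \<Rightarrow> bool" where
  "C_k 0 f \<longleftrightarrow> continuous_on UNIV f"
| "C_k (Suc k) f \<longleftrightarrow> (\<forall>x. f differentiable (at x)) \<and>
     (\<forall>b\<in>Basis. C_k k (\<lambda>x. frechet_derivative f (at x) b))"

text \<open>The space \<open>C\<^sub>c\<^sup>\<infinity>(\<Omega>)\<close>, each element being extended by zero to the whole space.\<close>

definition test_functions :: "'a::euclidean_space set \<Rightarrow> ('a \<Rightarrow> real) set" where
  "test_functions \<Omega> = {\<phi>. (\<forall>k. C_k k \<phi>) \<and>
     compact (closure {x. \<phi> x \<noteq> 0}) \<and> closure {x. \<phi> x \<noteq> 0} \<subseteq> \<Omega>}"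

definition gradient :: "('a::euclidean_space \<Rightarrow> real) \<Rightarrow> 'a \<Rightarrow> 'a" where
  "gradient \<phi> x = (\<Sum>b\<in>Basis. frechet_derivative \<phi> (at x) b *\<^sub>R b)"

definition distributional_div ::
    "'a::euclidean_space set \<Rightarrow> ('a \<Rightarrow> 'a) \<Rightarrow> ('a \<Rightarrow> real) \<Rightarrow> real" where
  "distributional_div \<Omega> X \<phi> = - (LINT x:\<Omega>|lebesgue. X x \<bullet> gradient \<phi> x)"

end

theory Submission
  imports Defs
begin

text \<open>The flux \<open>F(x,r)\<close> of \<open>X\<close> through the cube of size \<open>r\<close> centred at \<open>x\<close> is, as a function of \<open>x\<close>, the
  convolution of \<open>div X\<close> with the indicator of a cube. Hence \<open>F(\<cdot>,r) / r\<^sup>3\<close> converges to a positive multiple of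
  \<open>div X\<close> as distributions when \<open>r \<rightarrow> 0\<close>, and it suffices to show that the integral of \<open>|F(x,r)|\<close> over \<open>x\<close> is
  \<open>o(r\<^sup>3)\<close> along a sequence of sizes (\<open>divergence_free_if_integer_flux\<close>).

  Integrality gives this decay. For almost every pair \<open>(x,r)\<close> the number \<open>F(x,r)\<close> is an integer
  (\<open>AE_integer_flux\<close>), because almost every \<open>r\<close> is a Lebesgue point of the flux (\<open>AE_lebesgue_point\<close>). Let
  \<open>s r\<^sup>2\<close> be the area of the surface and \<open>\<lambda> = 1 / (2 s r\<^sup>2)\<close>. The part of \<open>X\<close> with \<open>|X| \<le> \<lambda>\<close> contributes at most
  \<open>1/2\<close> to the flux. A nonzero integer has modulus at least \<open>1\<close>, so \<open>|F|\<close> is at most twice the contribution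
  of the part with \<open>|X| > \<lambda>\<close>, where \<open>|X| \<le> \<lambda>\<^bsup>-1/2\<^esup> |X|\<^bsup>3/2\<^esup>\<close> (\<open>integer_mean_flux_bound\<close>). Integration over all
  centres turns the surface integral into \<open>s r\<^sup>2\<close> times a volume integral (\<open>nn_integral_shear\<close>), and the result is
  a constant times \<open>r\<^sup>3\<close> times the integral of \<open>|X|\<^bsup>3/2\<^esup>\<close> over \<open>{|X| > \<lambda>}\<close>. The last factor tends to zero, since
  \<open>\<lambda> \<rightarrow> \<infinity>\<close> and \<open>|X|\<^bsup>3/2\<^esup>\<close> is integrable; here \<open>p \<ge> 3/2\<close> enters. The field \<open>x / |x|\<^sup>3\<close>, whose
  divergence is a point mass, just fails to have this integrability.

  The surface integrals are taken with respect to the Hausdorff measure. The argument rests on these of its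
  properties: Borel sets are measurable (\<open>caratheodory_criterion\<close>), a similarity of ratio \<open>r\<close> multiplies area by
  \<open>r\<^sup>2\<close>, and for the cube the surface has finite area, the faces have positive area and the edges have area zero.
  The area of a face is the constant in \<open>integral_face_normal_moments\<close> and the multiple mentioned above.\<close>

section \<open>Borel sets are Hausdorff measurable\<close>

lemma outer_measure_UN:
  assumes f: "outer_measure_space UNIV f"
  shows "f (\<Union>i::nat. A i) \<le> (\<Sum>i. f (A i))"
proof -
  have "f (\<Union>i. A i) = f (\<Union>i. disjointed A i)"
    by (simp add: UN_disjointed_eq)
  also have "\<dots> \<le> (\<Sum>i. f (disjointed A i))"
    using f disjoint_family_disjointed[of A]
    by (auto simp: outer_measure_space_def countably_subadditive_def)
  also have "\<dots> \<le> (\<Sum>i. f (A i))"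
    using f disjointed_subset[of A]
    by (intro suminf_le) (auto simp: outer_measure_space_def increasing_def)
  finally show ?thesis .
qed

lemma outer_measure_Un:
  assumes f: "outer_measure_space UNIV f"
  shows "f (A \<union> B) \<le> f A + f B"
proof -
  have "f (A \<union> B) = f (\<Union>i. binaryset A B i)"
    by (simp add: UN_binaryset_eq)
  also have "\<dots> \<le> (\<Sum>i. f (binaryset A B i))" by (rule outer_measure_UN[OF f])
  also have "\<dots> = f A + f B"
    using f by (intro suminf_binaryset_eq) (auto simp: outer_measure_space_def positive_def)
  finally show ?thesis .
qed

text \<open>Slice the complement of \<open>C\<close> into the layers \<open>R n\<close> where the distance to \<open>C\<close> lies between
  \<open>1/(n+2)\<close> and \<open>1/(n+1)\<close>. Layers of equal parity are pairwise separated, so the sum of their outer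
  measures is at most twice \<open>f A\<close>. The tail of this convergent series bounds the part of \<open>A - C\<close> that is
  close to \<open>C\<close>, and the rest of \<open>A - C\<close> is separated from \<open>C\<close>.\<close>

lemma caratheodory_criterion:
  fixes f :: "'a::metric_space set \<Rightarrow> ennreal"
  assumes f: "outer_measure_space UNIV f"
    and sep: "\<And>A B e. 0 < e \<Longrightarrow> (\<And>a b. a \<in> A \<Longrightarrow> b \<in> B \<Longrightarrow> e \<le> dist a b) \<Longrightarrow> f A + f B \<le> f (A \<union> B)"
    and C: "closed C"
  shows "C \<in> lambda_system UNIV UNIV f"
proof -
  have mono: "f A \<le> f B" if "A \<subseteq> B" for A B
    using f that by (auto simp: outer_measure_space_def increasing_def)
  have empty: "f {} = 0"
    using f by (auto simp: outer_measure_space_def positive_def)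
  note UN = outer_measure_UN[OF f] and Un = outer_measure_Un[OF f]
  have "f (C \<inter> A) + f ((UNIV - C) \<inter> A) = f A" for A
  proof (rule antisym)
    show "f A \<le> f (C \<inter> A) + f ((UNIV - C) \<inter> A)"
      using Un[of "C \<inter> A" "(UNIV - C) \<inter> A"] by (metis Compl_eq_Diff_UNIV Int_Un_distrib2 Compl_partition Int_UNIV_left)
    show "f (C \<inter> A) + f ((UNIV - C) \<inter> A) \<le> f A"
    proof (cases "C = {} \<or> f A = top")
      case True
      then show ?thesis by (auto simp: empty)
    next
      case False
      then have ne: "C \<noteq> {}" and fin: "f A \<noteq> top" by auto
      define R where "R n = {x \<in> A. 1 / real (n + 2) < infdist x C \<and> infdist x C \<le> 1 / real (n + 1)}" for n :: nat
      define B where "B n = {x \<in> A. 1 / real (n + 1) < infdist x C}" for n :: nat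
      have lip: "infdist x C - infdist y C \<le> dist x y" for x y
        using infdist_triangle[of x C y] by simp
      \<comment> \<open>Two neighbouring layers touch; two layers of the same parity are separated by the layer
        between them.\<close>
      have alt: "(\<Sum>n<N. f (R (2 * n + k))) \<le> f (\<Union>n<N. R (2 * n + k))" for N k
      proof (induction N)
        case 0
        then show ?case by (simp add: empty)
      next
        case (Suc N)
        have "(\<Sum>n<Suc N. f (R (2 * n + k))) \<le> f (\<Union>n<N. R (2 * n + k)) + f (R (2 * N + k))"
          using Suc by (simp add: add_right_mono)
        also have "\<dots> \<le> f ((\<Union>n<N. R (2 * n + k)) \<union> R (2 * N + k))"
        proof (cases "N = 0")
          case True
          then show ?thesis by (simp add: empty)
        next
          case False
          let ?e = "1 / real (2 * N + k) - 1 / real (2 * N + k + 1)"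
          show ?thesis
          proof (rule sep[of ?e])
            have "1 / real (2 * N + k + 1) < 1 / real (2 * N + k)"
              using False by (intro divide_strict_left_mono) auto
            then show "0 < ?e" by simp
            fix a b assume "a \<in> (\<Union>n<N. R (2 * n + k))" and b: "b \<in> R (2 * N + k)"
            then obtain n where n: "n < N" "a \<in> R (2 * n + k)" by auto
            have "1 / real (2 * N + k) \<le> 1 / real (2 * n + k + 2)"
              using n by (intro divide_left_mono) auto
            then show "?e \<le> dist a b"
              using n b lip[of a b] by (simp add: R_def)
          qed
        qed
        also have "(\<Union>n<N. R (2 * n + k)) \<union> R (2 * N + k) = (\<Union>n<Suc N. R (2 * n + k))"
          by (auto simp: lessThan_Suc)
        finally show ?case .
      qed
      have altA: "(\<Sum>n<N. f (R (2 * n + k))) \<le> f A" for N k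
        by (rule order_trans[OF alt mono]) (auto simp: R_def)
      have double: "(\<Sum>n<2 * N. f (R n)) \<le> f A + f A" for N
      proof -
        have "(\<Sum>n<2 * N. f (R n)) = (\<Sum>n<N. f (R (2 * n + 0))) + (\<Sum>n<N. f (R (2 * n + 1)))"
          by (induction N) (auto simp: algebra_simps)
        also have "\<dots> \<le> f A + f A"
          by (intro add_mono altA)
        finally show ?thesis .
      qed
      have "(\<Sum>n. f (R n)) \<le> f A + f A"
      proof (rule suminf_le_const[OF summableI])
        fix n :: nat
        have "(\<Sum>i<n. f (R i)) \<le> (\<Sum>i<2 * n. f (R i))"
          by (intro sum_mono2) auto
        also note double
        finally show "(\<Sum>i<n. f (R i)) \<le> f A + f A" .
      qed
      also have "\<dots> < top" using fin by (simp add: less_top)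
      finally have sumfin: "(\<Sum>n. f (R n)) < top" .
      have Rfin: "f (R n) < top" for n
        using fin mono[of "R n" A] by (auto simp: R_def less_top intro: order.strict_trans1)
      define g where "g n = enn2real (f (R n))" for n
      have g: "ennreal (g n) = f (R n)" "0 \<le> g n" for n
        using Rfin by (auto simp: g_def)
      have sg: "summable g"
        using sumfin by (intro summable_suminf_not_top) (auto simp: g less_top)
      show ?thesis
      proof (rule ennreal_le_epsilon)
        fix e :: real assume e: "0 < e"
        obtain m where m: "\<And>n. n \<ge> m \<Longrightarrow> norm (\<Sum>i. g (i + n)) < e"
          using suminf_exist_split[OF e sg] by blast
        have "(UNIV - C) \<inter> A \<subseteq> B m \<union> (\<Union>i. R (i + m))"
        proof
          fix x assume x: "x \<in> (UNIV - C) \<inter> A"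
          then have pos: "0 < infdist x C"
            using C ne in_closed_iff_infdist_zero[of C x] infdist_nonneg[of x C] by force
          show "x \<in> B m \<union> (\<Union>i. R (i + m))"
          proof (cases "x \<in> B m")
            case nB: False
            let ?P = "\<lambda>k. 1 / real (k + 1) < infdist x C"
            have "\<exists>k. ?P k"
              using reals_Archimedean[OF pos] by (auto simp: inverse_eq_divide)
            define k where "k = (LEAST k. ?P k)"
            have k: "?P k"
              unfolding k_def by (rule LeastI_ex) fact
            have mk: "m < k"
            proof (rule ccontr)
              assume "\<not> m < k"
              then have "1 / real (m + 1) \<le> 1 / real (k + 1)"
                by (intro divide_left_mono) auto
              then have "x \<in> B m" using k x by (auto simp: B_def)
              with nB show False ..
            qed
            have "\<not> ?P (k - 1)"
              using mk unfolding k_def by (intro not_less_Least) auto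
            then have "x \<in> R (k - 1)"
              using k x mk by (auto simp: R_def of_nat_diff not_less)
            then have "x \<in> R ((k - 1 - m) + m)" using mk by simp
            then show ?thesis by blast
          qed auto
        qed
        then have "f ((UNIV - C) \<inter> A) \<le> f (B m) + f (\<Union>i. R (i + m))"
          using mono Un order_trans by blast
        also have "f (\<Union>i. R (i + m)) \<le> (\<Sum>i. f (R (i + m)))" by (rule UN)
        also have "\<dots> = (\<Sum>i. ennreal (g (i + m)))" by (simp add: g)
        also have "\<dots> = ennreal (\<Sum>i. g (i + m))"
          using sg by (intro suminf_ennreal2) (auto simp: g)
        also have "\<dots> \<le> ennreal e"
          using m[of m] by (intro ennreal_leI) auto
        finally have tail: "f ((UNIV - C) \<inter> A) \<le> f (B m) + ennreal e"
          by (simp add: add_left_mono)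
        have "f (C \<inter> A) + f (B m) \<le> f ((C \<inter> A) \<union> B m)"
        proof (rule sep[of "1 / real (m + 1)"])
          fix a b assume "a \<in> C \<inter> A" "b \<in> B m"
          then show "1 / real (m + 1) \<le> dist a b"
            using lip[of b a] by (auto simp: B_def dist_commute)
        qed auto
        also have "\<dots> \<le> f A" by (rule mono) (auto simp: B_def)
        finally have "f (C \<inter> A) + f (B m) \<le> f A" .
        then have "f (C \<inter> A) + (f (B m) + ennreal e) \<le> f A + ennreal e"
          by (simp add: add.assoc[symmetric] add_right_mono)
        then show "f (C \<inter> A) + f ((UNIV - C) \<inter> A) \<le> f A + ennreal e"
          using tail by (meson add_left_mono order_trans)
      qed
    qed
  qed
  then show ?thesis by (auto simp: lambda_system_def)
qed

lemma hausdorff_weight_mono: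
  assumes "0 \<le> s" "A \<subseteq> B" "bounded B"
  shows "hausdorff_weight s A \<le> hausdorff_weight s B"
  unfolding hausdorff_weight_def using assms
  by (intro ennreal_leI mult_left_mono powr_mono2 divide_right_mono diameter_subset
        unit_ball_vol_nonneg) (auto intro: diameter_ge_0 bounded_subset)

lemma hausdorff_weight_empty [simp]: "hausdorff_weight s {} = 0"
  by (simp add: hausdorff_weight_def diameter_def)

lemma hausdorff_pre_antimono: "\<delta> \<le> \<delta>' \<Longrightarrow> hausdorff_pre s \<delta>' A \<le> hausdorff_pre s \<delta> A"
  unfolding hausdorff_pre_def hausdorff_covers_def
  by (rule INF_superset_mono) (auto intro: order_trans)

lemma hausdorff_pre_le_outer: "0 < \<delta> \<Longrightarrow> hausdorff_pre s \<delta> A \<le> hausdorff_outer s A"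
  unfolding hausdorff_outer_def by (rule SUP_upper) simp

lemma hausdorff_outer_mono: "A \<subseteq> B \<Longrightarrow> hausdorff_outer s A \<le> hausdorff_outer s B"
  using outer_measure_space_hausdorff by (auto simp: outer_measure_space_def increasing_def)

text \<open>A covering set of diameter below \<open>e\<close> meets at most one of the two sets, so a cover of the union
  splits into two covers.\<close>

lemma hausdorff_pre_separated:
  fixes A B :: "'a::metric_space set"
  assumes s: "0 \<le> s" and d: "\<delta> < e" and sep: "\<And>a b. a \<in> A \<Longrightarrow> b \<in> B \<Longrightarrow> e \<le> dist a b"
  shows "hausdorff_pre s \<delta> A + hausdorff_pre s \<delta> B \<le> hausdorff_pre s \<delta> (A \<union> B)"
  unfolding hausdorff_pre_def[of s \<delta> "A \<union> B"]
proof (rule INF_greatest)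
  fix E assume E: "E \<in> hausdorff_covers \<delta> (A \<union> B)"
  then have bd: "bounded (E i)" "diameter (E i) \<le> \<delta>" and cov: "A \<union> B \<subseteq> (\<Union>i. E i)" for i
    by (auto simp: hausdorff_covers_def)
  have *: "(\<lambda>i. E i \<inter> D) \<in> hausdorff_covers \<delta> D" if "D \<subseteq> A \<union> B" for D
    unfolding hausdorff_covers_def
  proof (intro CollectI conjI allI)
    show "D \<subseteq> (\<Union>i. E i \<inter> D)" using that cov by auto
    show "bounded (E i \<inter> D)" for i using bd(1)[of i] by (rule bounded_subset) auto
    show "diameter (E i \<inter> D) \<le> \<delta>" for i
      using diameter_subset[of "E i \<inter> D" "E i"] bd[of i] by auto
  qed
  have split: "hausdorff_weight s (E i \<inter> A) + hausdorff_weight s (E i \<inter> B) \<le> hausdorff_weight s (E i)" for i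
  proof -
    have "E i \<inter> A = {} \<or> E i \<inter> B = {}"
    proof (rule ccontr)
      assume "\<not> ?thesis"
      then obtain a b where ab: "a \<in> E i" "a \<in> A" "b \<in> E i" "b \<in> B" by blast
      then have "dist a b \<le> diameter (E i)"
        using bd diameter_bounded_bound by blast
      then show False using sep[of a b] ab d bd(2)[of i] by linarith
    qed
    then show ?thesis
      using hausdorff_weight_mono[OF s _ bd(1)[of i], of "E i \<inter> A"]
        hausdorff_weight_mono[OF s _ bd(1)[of i], of "E i \<inter> B"] by auto
  qed
  have "hausdorff_pre s \<delta> A + hausdorff_pre s \<delta> B
      \<le> (\<Sum>i. hausdorff_weight s (E i \<inter> A)) + (\<Sum>i. hausdorff_weight s (E i \<inter> B))"
    unfolding hausdorff_pre_def by (intro add_mono INF_lower *) auto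
  also have "\<dots> = (\<Sum>i. hausdorff_weight s (E i \<inter> A) + hausdorff_weight s (E i \<inter> B))"
    by (rule suminf_add) auto
  also have "\<dots> \<le> (\<Sum>i. hausdorff_weight s (E i))"
    by (intro suminf_le split) auto
  finally show "hausdorff_pre s \<delta> A + hausdorff_pre s \<delta> B \<le> (\<Sum>i. hausdorff_weight s (E i))" .
qed

lemma hausdorff_outer_separated:
  fixes A B :: "'a::metric_space set"
  assumes s: "0 \<le> s" and e: "0 < e" and sep: "\<And>a b. a \<in> A \<Longrightarrow> b \<in> B \<Longrightarrow> e \<le> dist a b"
  shows "hausdorff_outer s A + hausdorff_outer s B \<le> hausdorff_outer s (A \<union> B)"
proof -
  have *: "hausdorff_pre s \<delta> A + hausdorff_pre s \<delta>' B \<le> hausdorff_outer s (A \<union> B)"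
    if "0 < \<delta>" "0 < \<delta>'" for \<delta> \<delta>'
  proof -
    let ?d = "min (min \<delta> \<delta>') (e / 2)"
    have "hausdorff_pre s \<delta> A + hausdorff_pre s \<delta>' B \<le> hausdorff_pre s ?d A + hausdorff_pre s ?d B"
      by (intro add_mono hausdorff_pre_antimono) auto
    also have "\<dots> \<le> hausdorff_pre s ?d (A \<union> B)"
      using e by (intro hausdorff_pre_separated[OF s _ sep]) auto
    also have "\<dots> \<le> hausdorff_outer s (A \<union> B)"
      using that e by (intro hausdorff_pre_le_outer) auto
    finally show ?thesis .
  qed
  have "hausdorff_outer s A + hausdorff_pre s \<delta>' B \<le> hausdorff_outer s (A \<union> B)" if "0 < \<delta>'" for \<delta>'
    unfolding hausdorff_outer_def[of s A]
    by (subst ennreal_SUP_add_left[symmetric]) (use that in \<open>auto intro!: SUP_least *\<close>)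
  then show ?thesis
    unfolding hausdorff_outer_def[of s B]
    by (subst add.commute, subst ennreal_SUP_add_left[symmetric]) (auto intro!: SUP_least simp: add.commute)
qed

lemma borel_sets_hausdorff_measure:
  assumes "0 \<le> s" "A \<in> sets borel"
  shows "A \<in> sets (hausdorff_measure s)"
proof -
  have "A \<in> sigma_sets UNIV {C. closed C}"
    using assms(2) by (simp add: borel_eq_closed)
  then show ?thesis
  proof (induction rule: sigma_sets.induct)
    case (Basic a)
    then show ?case
      unfolding sets_hausdorff_measure using assms(1)
      by (intro caratheodory_criterion outer_measure_space_hausdorff)
         (auto intro: hausdorff_outer_separated)
  next
    case (Compl a)
    then show ?case
      using sets.compl_sets[of a "hausdorff_measure s"] by simp
  qed auto
qed

text \<open>Completeness of the Hausdorff measure: it lets a field that agrees with a Borel field off a null set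
  be integrated over a surface.\<close>

lemma hausdorff_null_in_sets:
  assumes "hausdorff_outer s N = 0" "A \<subseteq> N"
  shows "A \<in> null_sets (hausdorff_measure s)"
proof -
  have A: "hausdorff_outer s A = 0"
    using hausdorff_outer_mono[OF assms(2), of s] assms(1) by simp
  have "hausdorff_outer s (A \<inter> B) + hausdorff_outer s ((UNIV - A) \<inter> B) = hausdorff_outer s B" for B
  proof -
    have 0: "hausdorff_outer s (A \<inter> B) = 0"
      using hausdorff_outer_mono[of "A \<inter> B" A s] A by simp
    have "hausdorff_outer s B = hausdorff_outer s ((A \<inter> B) \<union> ((UNIV - A) \<inter> B))"
      by (rule arg_cong[where f = "hausdorff_outer s"]) auto
    also have "\<dots> \<le> hausdorff_outer s (A \<inter> B) + hausdorff_outer s ((UNIV - A) \<inter> B)"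
      by (rule outer_measure_Un[OF outer_measure_space_hausdorff])
    finally show ?thesis
      using 0 hausdorff_outer_mono[of "(UNIV - A) \<inter> B" B s] by (simp add: antisym)
  qed
  then have "A \<in> sets (hausdorff_measure s)"
    unfolding sets_hausdorff_measure by (auto simp: lambda_system_def)
  then show ?thesis
    using A by (auto simp: null_sets_def emeasure_hausdorff_measure)
qed

section \<open>Hausdorff measure under Lipschitz maps and similarities\<close>

lemma hausdorff_pre_Lipschitz_image:
  fixes f :: "'a::metric_space \<Rightarrow> 'b::metric_space"
  assumes s: "0 \<le> s" and L: "0 < L" and f: "\<And>x y. dist (f x) (f y) \<le> L * dist x y"
  shows "hausdorff_pre s (L * \<delta>) (f ` A) \<le> ennreal (L powr s) * hausdorff_pre s \<delta> A"
proof -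
  have Ls: "0 < ennreal (L powr s)"
    using L by simp
  have "hausdorff_pre s (L * \<delta>) (f ` A) / ennreal (L powr s) \<le> hausdorff_pre s \<delta> A"
    unfolding hausdorff_pre_def[of s \<delta> A]
  proof (rule INF_greatest)
    fix E assume E: "E \<in> hausdorff_covers \<delta> A"
    have bd: "bounded (f ` E i)" and dm: "diameter (f ` E i) \<le> L * diameter (E i)" for i
    proof -
      have b: "bounded (E i)" using E by (auto simp: hausdorff_covers_def)
      then have le: "dist x y \<le> L * diameter (E i)" if "x \<in> f ` E i" "y \<in> f ` E i" for x y
        using that L by (auto intro!: order_trans[OF f] mult_left_mono diameter_bounded_bound)
      then show "bounded (f ` E i)"
        unfolding bounded_two_points by blast
      show "diameter (f ` E i) \<le> L * diameter (E i)"
      proof (cases "E i = {}")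
        case False
        then show ?thesis
          unfolding diameter_def[of "f ` E i"] using le by (auto intro!: cSUP_least)
      qed (simp add: diameter_def)
    qed
    have "(\<lambda>i. f ` E i) \<in> hausdorff_covers (L * \<delta>) (f ` A)"
      using E bd L image_mono[of A "\<Union>i. E i" f] unfolding hausdorff_covers_def
      by (auto intro!: order_trans[OF dm] mult_left_mono simp: image_UN)
    then have "hausdorff_pre s (L * \<delta>) (f ` A) \<le> (\<Sum>i. hausdorff_weight s (f ` E i))"
      unfolding hausdorff_pre_def by (rule INF_lower)
    also have "\<dots> \<le> (\<Sum>i. ennreal (L powr s) * hausdorff_weight s (E i))"
    proof (intro suminf_le)
      fix i
      have "bounded (E i)" using E by (auto simp: hausdorff_covers_def)
      then have d0: "0 \<le> diameter (E i)" by (rule diameter_ge_0)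
      have "(diameter (f ` E i) / 2) powr s \<le> (L * (diameter (E i) / 2)) powr s"
        using dm[of i] bd[of i] s by (intro powr_mono2) (auto intro: diameter_ge_0)
      also have "\<dots> = L powr s * (diameter (E i) / 2) powr s"
        using L d0 by (intro powr_mult)
      finally show "hausdorff_weight s (f ` E i) \<le> ennreal (L powr s) * hausdorff_weight s (E i)"
        unfolding hausdorff_weight_def using s
        by (subst ennreal_mult'[symmetric])
           (auto intro!: ennreal_leI mult_left_mono unit_ball_vol_nonneg simp: mult.left_commute[of "L powr s"])
    qed auto
    also have "\<dots> = ennreal (L powr s) * (\<Sum>i. hausdorff_weight s (E i))"
      by simp
    finally show "hausdorff_pre s (L * \<delta>) (f ` A) / ennreal (L powr s) \<le> (\<Sum>i. hausdorff_weight s (E i))"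
      using Ls by (intro divide_le_posI_ennreal) (auto simp: mult.commute)
  qed
  then have "hausdorff_pre s (L * \<delta>) (f ` A) / ennreal (L powr s) * ennreal (L powr s)
      \<le> hausdorff_pre s \<delta> A * ennreal (L powr s)"
    by (rule mult_right_mono) simp
  then show ?thesis
    using Ls by (simp add: ennreal_divide_times ennreal_divide_self)
       (simp add: mult.commute)
qed

lemma hausdorff_outer_Lipschitz_image:
  fixes f :: "'a::metric_space \<Rightarrow> 'b::metric_space"
  assumes s: "0 \<le> s" and L: "0 < L" and f: "\<And>x y. dist (f x) (f y) \<le> L * dist x y"
  shows "hausdorff_outer s (f ` A) \<le> ennreal (L powr s) * hausdorff_outer s A"
  unfolding hausdorff_outer_def[of s "f ` A"]
proof (rule SUP_least)
  fix \<delta> :: real assume "\<delta> \<in> {0<..}"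
  then have d: "0 < \<delta> / L" using L by simp
  have "hausdorff_pre s \<delta> (f ` A) \<le> ennreal (L powr s) * hausdorff_pre s (\<delta> / L) A"
    using hausdorff_pre_Lipschitz_image[OF s L f, of "\<delta> / L" A] L by simp
  also have "\<dots> \<le> ennreal (L powr s) * hausdorff_outer s A"
    by (intro mult_left_mono hausdorff_pre_le_outer d) simp
  finally show "hausdorff_pre s \<delta> (f ` A) \<le> ennreal (L powr s) * hausdorff_outer s A" .
qed

text \<open>The inverse of a similarity of ratio \<open>r\<close> is Lipschitz with constant \<open>1/r\<close>, so the Lipschitz
  estimate holds in both directions.\<close>

lemma hausdorff_outer_similarity:
  fixes f :: "'a::metric_space \<Rightarrow> 'b::metric_space"
  assumes s: "0 \<le> s" and r: "0 < r" and f: "\<And>x y. dist (f x) (f y) = r * dist x y" and "surj f"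
  shows "hausdorff_outer s (f ` A) = ennreal (r powr s) * hausdorff_outer s A"
proof (rule antisym)
  show "hausdorff_outer s (f ` A) \<le> ennreal (r powr s) * hausdorff_outer s A"
    using assms by (intro hausdorff_outer_Lipschitz_image) auto
  have fg: "f (inv f y) = y" for y
    using \<open>surj f\<close> by (rule surj_f_inv_f)
  have "inj f"
  proof (rule injI)
    fix x y assume "f x = f y"
    then show "x = y" using f[of x y] r by simp
  qed
  have "dist (inv f x) (inv f y) \<le> 1 / r * dist x y" for x y
    using f[of "inv f x" "inv f y"] r by (simp add: fg field_simps)
  then have "hausdorff_outer s (inv f ` (f ` A)) \<le> ennreal ((1 / r) powr s) * hausdorff_outer s (f ` A)"
    using r s by (intro hausdorff_outer_Lipschitz_image) auto
  also have "inv f ` (f ` A) = A"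
    using \<open>inj f\<close> by (simp add: image_inv_f_f)
  finally have "ennreal (r powr s) * hausdorff_outer s A
      \<le> ennreal (r powr s) * (ennreal ((1 / r) powr s) * hausdorff_outer s (f ` A))"
    by (rule mult_left_mono) simp
  also have "\<dots> = ennreal (r powr s * (1 / r) powr s) * hausdorff_outer s (f ` A)"
    by (simp add: ennreal_mult mult.assoc)
  also have "r powr s * (1 / r) powr s = 1"
    using r by (simp add: powr_mult[symmetric])
  finally show "ennreal (r powr s) * hausdorff_outer s A \<le> hausdorff_outer s (f ` A)"
    by simp
qed

section \<open>The area of the faces of a cube\<close>

lemma hausdorff_pre_finite_UN:
  assumes "finite P" "0 < \<delta>"
  shows "hausdorff_pre s \<delta> (\<Union>p\<in>P. A p) \<le> (\<Sum>p\<in>P. hausdorff_pre s \<delta> (A p))"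
  using assms(1)
proof (induction P)
  case empty
  then show ?case using assms(2) by (simp add: hausdorff_pre_empty)
next
  case (insert p P)
  have "hausdorff_pre s \<delta> (\<Union>p\<in>insert p P. A p) = hausdorff_pre s \<delta> (\<Union>i. binaryset (A p) (\<Union>p\<in>P. A p) i)"
    by (simp add: UN_binaryset_eq)
  also have "\<dots> \<le> (\<Sum>i. hausdorff_pre s \<delta> (binaryset (A p) (\<Union>p\<in>P. A p) i))"
    by (rule hausdorff_pre_UN)
  also have "\<dots> = hausdorff_pre s \<delta> (A p) + hausdorff_pre s \<delta> (\<Union>p\<in>P. A p)"
    using assms(2) by (intro suminf_binaryset_eq hausdorff_pre_empty)
  also have "\<dots> \<le> (\<Sum>p\<in>insert p P. hausdorff_pre s \<delta> (A p))"
    using insert by (simp add: add_left_mono)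
  finally show ?case .
qed

text \<open>Self-similarity replaces explicit covers. A set that is covered by \<open>k\<close> copies of itself, each
  shrunk by the factor \<open>1/2\<close>, has at scale \<open>\<delta>/2\<close> at most \<open>k/4\<close> times its area at scale \<open>\<delta>\<close>. A square
  needs four half copies, which gives finite area, and a segment needs two, which gives area zero.\<close>

lemma hausdorff_pre_half_copies:
  fixes A P :: "'a::real_normed_vector set"
  assumes P: "finite P" and \<delta>: "0 < \<delta>" and A: "A \<subseteq> (\<Union>p\<in>P. (\<lambda>w. (1/2) *\<^sub>R (w + p)) ` A)"
  shows "hausdorff_pre 2 (\<delta> / 2) A \<le> ennreal (card P / 4) * hausdorff_pre 2 \<delta> A"
proof -
  have "hausdorff_pre 2 (1/2 * \<delta>) A \<le> hausdorff_pre 2 (1/2 * \<delta>) (\<Union>p\<in>P. (\<lambda>w. (1/2) *\<^sub>R (w + p)) ` A)"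
    by (rule hausdorff_pre_mono) fact
  also have "\<dots> \<le> (\<Sum>p\<in>P. hausdorff_pre 2 (1/2 * \<delta>) ((\<lambda>w. (1/2) *\<^sub>R (w + p)) ` A))"
    using P \<delta> by (intro hausdorff_pre_finite_UN) auto
  also have "\<dots> \<le> (\<Sum>p\<in>P. ennreal ((1/2) powr 2) * hausdorff_pre 2 \<delta> A)"
    by (intro sum_mono hausdorff_pre_Lipschitz_image)
       (auto simp: dist_norm scaleR_diff_right[symmetric])
  also have "\<dots> = ennreal (card P / 4) * hausdorff_pre 2 \<delta> A"
    by (simp add: powr_numeral power2_eq_square ennreal_of_nat_eq_real_of_nat mult.assoc[symmetric] ennreal_mult[symmetric])
  finally show ?thesis by simp
qed

text \<open>The approximating areas do not increase when the scale is halved, so all of them are bounded by the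
  weight of the single covering set \<open>A\<close>.\<close>

lemma hausdorff_outer_finite_if_four_half_copies:
  fixes A P :: "'a::real_normed_vector set"
  assumes P: "finite P" "card P \<le> 4" and bd: "bounded A"
    and A: "A \<subseteq> (\<Union>p\<in>P. (\<lambda>w. (1/2) *\<^sub>R (w + p)) ` A)"
  shows "hausdorff_outer 2 A < top"
proof -
  define D where "D = diameter A + 1"
  have D: "0 < D" "diameter A \<le> D"
    using diameter_ge_0[OF bd] by (auto simp: D_def)
  have *: "hausdorff_pre 2 (D / 2 ^ n) A \<le> hausdorff_pre 2 D A" for n
  proof (induction n)
    case (Suc n)
    have "hausdorff_pre 2 (D / 2 ^ n / 2) A \<le> ennreal (card P / 4) * hausdorff_pre 2 (D / 2 ^ n) A"
      using P A D by (intro hausdorff_pre_half_copies) auto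
    also have "\<dots> \<le> 1 * hausdorff_pre 2 (D / 2 ^ n) A"
      using P by (intro mult_right_mono) (auto simp flip: ennreal_1 intro!: ennreal_leI)
    finally show ?case using Suc by (simp add: field_simps)
  qed simp
  have "hausdorff_outer 2 A \<le> hausdorff_pre 2 D A"
    unfolding hausdorff_outer_def
  proof (rule SUP_least)
    fix \<delta> :: real assume "\<delta> \<in> {0<..}"
    then obtain n where "D / \<delta> < 2 ^ n"
      using real_arch_pow[of 2 "D / \<delta>"] by auto
    then have "D / 2 ^ n \<le> \<delta>"
      using \<open>\<delta> \<in> {0<..}\<close> by (simp add: field_simps)
    then show "hausdorff_pre 2 \<delta> A \<le> hausdorff_pre 2 D A"
      using hausdorff_pre_antimono *[of n] order_trans by blast
  qed
  also have "\<dots> \<le> (\<Sum>i::nat. hausdorff_weight 2 (if i = 0 then A else {}))"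
    unfolding hausdorff_pre_def using bd D
    by (intro INF_lower) (auto simp: hausdorff_covers_def)
  also have "\<dots> = hausdorff_weight 2 A"
    by (subst suminf_finite[of "{0}"]) auto
  also have "\<dots> < top" by (simp add: hausdorff_weight_def)
  finally show ?thesis .
qed

text \<open>The area is finite and at most half of itself.\<close>

lemma hausdorff_outer_null_if_two_half_copies:
  fixes A P :: "'a::real_normed_vector set"
  assumes P: "finite P" "card P \<le> 2" and bd: "bounded A"
    and A: "A \<subseteq> (\<Union>p\<in>P. (\<lambda>w. (1/2) *\<^sub>R (w + p)) ` A)"
  shows "hausdorff_outer 2 A = 0"
proof -
  have fin: "hausdorff_outer 2 A < top"
    using P bd A by (intro hausdorff_outer_finite_if_four_half_copies[of P]) auto
  have "hausdorff_pre 2 \<delta> A \<le> ennreal (1/2) * hausdorff_outer 2 A" if d: "0 < \<delta>" for \<delta>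
  proof -
    have "hausdorff_pre 2 (2 * \<delta> / 2) A \<le> ennreal (card P / 4) * hausdorff_pre 2 (2 * \<delta>) A"
      using P A d by (intro hausdorff_pre_half_copies) auto
    also have "\<dots> \<le> ennreal (1/2) * hausdorff_outer 2 A"
      using P d by (intro mult_mono hausdorff_pre_le_outer ennreal_leI) auto
    finally show ?thesis by simp
  qed
  then have "(SUP \<delta>\<in>{0<..}. hausdorff_pre 2 \<delta> A) \<le> ennreal (1/2) * hausdorff_outer 2 A"
    by (intro SUP_least) auto
  then have "hausdorff_outer 2 A \<le> ennreal (1/2) * hausdorff_outer 2 A"
    by (simp add: hausdorff_outer_def)
  moreover obtain a where a: "hausdorff_outer 2 A = ennreal a" "0 \<le> a"
    using fin by (cases "hausdorff_outer 2 A") auto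
  ultimately have "ennreal a \<le> ennreal (1/2 * a)"
    by (subst ennreal_mult) auto
  with a show ?thesis by simp
qed

lemma other_coordinates:
  fixes i :: 3
  obtains j k where "j \<noteq> i" "k \<noteq> i" "j \<noteq> k" "\<And>l. l = i \<or> l = j \<or> l = k"
proof -
  have "\<exists>j k. j \<noteq> i \<and> k \<noteq> i \<and> j \<noteq> k \<and> (\<forall>l. l = i \<or> l = j \<or> l = k)"
    using exhaust_3[of i]
  proof (elim disjE)
    assume "i = 1" then show ?thesis by (intro exI[of _ 2] exI[of _ 3]) (auto simp: forall_3)
  next
    assume "i = 2" then show ?thesis by (intro exI[of _ 1] exI[of _ 3]) (auto simp: forall_3)
  next
    assume "i = 3" then show ?thesis by (intro exI[of _ 1] exI[of _ 2]) (auto simp: forall_3)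
  qed
  then show thesis using that by blast
qed

definition face :: "3 \<Rightarrow> real \<Rightarrow> (real^3) set" where
  "face i a = {w. w $ i = a \<and> (\<forall>l. \<bar>w $ l\<bar> \<le> 1/2)}"

definition open_face :: "3 \<Rightarrow> real \<Rightarrow> (real^3) set" where
  "open_face i a = {w. w $ i = a \<and> (\<forall>j. j \<noteq> i \<longrightarrow> \<bar>w $ j\<bar> < 1/2)}"

lemma mem_centred_cbox: "(w :: real^3) \<in> cbox (\<chi> _. -1/2) (\<chi> _. 1/2) \<longleftrightarrow> (\<forall>i. \<bar>w $ i\<bar> \<le> 1/2)"
proof -
  have "(-1/2 \<le> t \<and> t \<le> 1/2) = (\<bar>t\<bar> \<le> 1/2)" for t :: real by arith
  then show ?thesis by (simp add: mem_box_cart)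
qed

lemma mem_centred_box: "(w :: real^3) \<in> box (\<chi> _. -1/2) (\<chi> _. 1/2) \<longleftrightarrow> (\<forall>i. \<bar>w $ i\<bar> < 1/2)"
proof -
  have "(-1/2 < t \<and> t < 1/2) = (\<bar>t\<bar> < 1/2)" for t :: real by arith
  then show ?thesis by (simp add: mem_box_cart)
qed

lemma bounded_face: "bounded (face i a)"
proof (rule bounded_subset)
  show "bounded (cbox (\<chi> _. -1/2) (\<chi> _. 1/2) :: (real^3) set)" by (rule bounded_cbox)
  show "face i a \<subseteq> cbox (\<chi> _. -1/2) (\<chi> _. 1/2)"
    unfolding face_def by (blast intro: mem_centred_cbox[THEN iffD2])
qed

text \<open>The half copies are the contractions towards the four corners of the face; a point lies in the
  copy of the corner whose coordinates have the same signs.\<close>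

lemma hausdorff_outer_face_finite: "hausdorff_outer 2 (face i a) < top"
proof -
  obtain j k where jk: "j \<noteq> i" "k \<noteq> i" "j \<noteq> k" "\<And>l. l = i \<or> l = j \<or> l = k"
    by (rule other_coordinates[of i]) blast
  define c :: "real \<times> real \<Rightarrow> real^3" where
    "c = (\<lambda>(u, v). \<chi> l. if l = i then a else if l = j then u else v)"
  define P where "P = c ` ({-1/2, 1/2} \<times> {-1/2, 1/2})"
  show ?thesis
  proof (rule hausdorff_outer_finite_if_four_half_copies[of P])
    show "finite P" by (simp add: P_def)
    have "card P \<le> card ({-1/2, 1/2 :: real} \<times> {-1/2, 1/2 :: real})"
      unfolding P_def by (rule card_image_le) simp
    then show "card P \<le> 4" by (simp add: card_insert_if)
    show "bounded (face i a)" by (rule bounded_face)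
    show "face i a \<subseteq> (\<Union>p\<in>P. (\<lambda>w. (1/2) *\<^sub>R (w + p)) ` face i a)"
    proof
      fix w assume w: "w \<in> face i a"
      define p where "p = c (if 0 \<le> w $ j then 1/2 else -1/2, if 0 \<le> w $ k then 1/2 else -1/2)"
      have "p \<in> P" by (auto simp: P_def p_def)
      moreover have "w = (1/2) *\<^sub>R ((2 *\<^sub>R w - p) + p)" by simp
      moreover have "2 *\<^sub>R w - p \<in> face i a"
      proof -
        have half: "\<bar>2 * t - (if 0 \<le> t then 1/2 else -1/2)\<bar> \<le> 1/2" if "\<bar>t\<bar> \<le> 1/2" for t :: real
          using that unfolding abs_le_iff by (auto split: if_splits)
        have wl: "\<bar>w $ l\<bar> \<le> 1/2" for l using w by (auto simp: face_def)
        have "\<bar>(2 *\<^sub>R w - p) $ l\<bar> \<le> 1/2" for l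
          using jk(4)[of l]
        proof (elim disjE)
          assume "l = i"
          then show ?thesis using wl[of i] w by (simp add: face_def p_def c_def)
        next
          assume "l = j"
          then show ?thesis using half[OF wl[of j]] w by (simp add: face_def p_def c_def jk(1-3) jk(3)[symmetric])
        next
          assume "l = k"
          then show ?thesis using half[OF wl[of k]] by (simp add: p_def c_def jk(1-3) jk(3)[symmetric])
        qed
        then show ?thesis using w by (auto simp: face_def p_def c_def)
      qed
      ultimately show "w \<in> (\<Union>p\<in>P. (\<lambda>w. (1/2) *\<^sub>R (w + p)) ` face i a)" by blast
    qed
  qed
qed

text \<open>The half copies are the contractions towards the two endpoints of the edge.\<close>

lemma hausdorff_outer_edge_null:
  assumes ij: "i \<noteq> j"
  shows "hausdorff_outer 2 (face i a \<inter> face j b) = 0"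
proof -
  define c :: "real \<Rightarrow> real^3" where
    "c = (\<lambda>u. \<chi> l. if l = i then a else if l = j then b else u)"
  define P where "P = c ` {-1/2, 1/2}"
  obtain k where k: "k \<noteq> i" "k \<noteq> j" "\<And>l. l = i \<or> l = j \<or> l = k"
    by (rule other_coordinates[of i]) (metis ij)
  show ?thesis
  proof (rule hausdorff_outer_null_if_two_half_copies[of P])
    show "finite P" by (simp add: P_def)
    have "card P \<le> card {-1/2, 1/2 :: real}"
      unfolding P_def by (rule card_image_le) simp
    then show "card P \<le> 2" by (simp add: card_insert_if)
    show "bounded (face i a \<inter> face j b)" by (intro bounded_Int disjI1 bounded_face)
    show "face i a \<inter> face j b \<subseteq> (\<Union>p\<in>P. (\<lambda>w. (1/2) *\<^sub>R (w + p)) ` (face i a \<inter> face j b))"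
    proof
      fix w assume w: "w \<in> face i a \<inter> face j b"
      define p where "p = c (if 0 \<le> w $ k then 1/2 else -1/2)"
      have "p \<in> P" by (auto simp: P_def p_def)
      moreover have "w = (1/2) *\<^sub>R ((2 *\<^sub>R w - p) + p)" by simp
      moreover have "2 *\<^sub>R w - p \<in> face i a \<inter> face j b"
      proof -
        have half: "\<bar>2 * t - (if 0 \<le> t then 1/2 else -1/2)\<bar> \<le> 1/2" if "\<bar>t\<bar> \<le> 1/2" for t :: real
          using that unfolding abs_le_iff by (auto split: if_splits)
        have wl: "\<bar>w $ l\<bar> \<le> 1/2" for l using w by (auto simp: face_def)
        have "\<bar>(2 *\<^sub>R w - p) $ l\<bar> \<le> 1/2" for l
          using k(3)[of l]
        proof (elim disjE)
          assume "l = i"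
          then show ?thesis using wl[of i] w by (simp add: face_def p_def c_def)
        next
          assume "l = j"
          then show ?thesis using wl[of j] w by (simp add: face_def p_def c_def k(1,2) ij ij[symmetric])
        next
          assume "l = k"
          then show ?thesis using half[OF wl[of k]] by (simp add: p_def c_def k(1,2) ij ij[symmetric])
        qed
        then show ?thesis using w ij by (auto simp: face_def p_def c_def)
      qed
      ultimately show "w \<in> (\<Union>p\<in>P. (\<lambda>w. (1/2) *\<^sub>R (w + p)) ` (face i a \<inter> face j b))" by blast
    qed
  qed
qed

text \<open>Extend every covering set of diameter \<open>d\<close> to a box of base \<open>2d \<times> 2d\<close> and height one, orthogonal
  to the face. These boxes cover the unit cube, so \<open>\<Sum> 4 d\<^sup>2 \<ge> 1\<close>, while the weight of the covering set is
  \<open>\<pi> d\<^sup>2 / 4\<close>.\<close>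

lemma hausdorff_pre_open_face_ge: "ennreal (pi / 16) \<le> hausdorff_pre 2 \<delta> (open_face i a)"
  unfolding hausdorff_pre_def
proof (rule INF_greatest)
  fix E assume E: "E \<in> hausdorff_covers \<delta> (open_face i a)"
  define d where "d n = diameter (E n)" for n
  have bd: "bounded (E n)" for n using E by (auto simp: hausdorff_covers_def)
  have d: "0 \<le> d n" for n using bd by (simp add: d_def diameter_ge_0)
  define p where "p n = (SOME w. w \<in> E n)" for n
  have p: "p n \<in> E n" if "w \<in> E n" for w n
    unfolding p_def using that by (rule someI)
  define Q where "Q n = cbox (\<chi> l. if l = i then -1/2 else p n $ l - d n) (\<chi> l. if l = i then 1/2 else p n $ l + d n)" for n
  have vol: "emeasure lborel (Q n) = ennreal (4 * (d n)^2)" for n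
  proof -
    obtain j k where jk: "j \<noteq> i" "k \<noteq> i" "j \<noteq> k" "\<And>l. l = i \<or> l = j \<or> l = k"
      by (rule other_coordinates[of i]) blast
    then have U: "UNIV = {i, j, k}" by auto
    have "Q n \<noteq> {}"
      using d[of n] by (auto simp: Q_def interval_ne_empty_cart)
    then have "measure lebesgue (Q n) = 4 * (d n)^2"
      unfolding Q_def using jk by (simp add: content_cbox_cart U power2_eq_square)
    moreover have "emeasure lborel (Q n) < \<infinity>"
      unfolding Q_def by (rule emeasure_lborel_cbox_finite)
    ultimately show ?thesis
      using emeasure_eq_ennreal_measure[of lborel "Q n"] by (simp add: Q_def less_top)
  qed
  have cov: "box (\<chi> _. -1/2) (\<chi> _. 1/2) \<subseteq> (\<Union>n. Q n)"
  proof
    fix x :: "real^3" assume x: "x \<in> box (\<chi> _. -1/2) (\<chi> _. 1/2)"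
    define y where "y = (\<chi> l. if l = i then a else x $ l)"
    have "y \<in> open_face i a"
      using x unfolding mem_centred_box by (auto simp: open_face_def y_def)
    then obtain n where n: "y \<in> E n" using E by (auto simp: hausdorff_covers_def)
    then have dy: "dist y (p n) \<le> d n"
      unfolding d_def using p bd by (intro diameter_bounded_bound) auto
    have "\<bar>x $ l - p n $ l\<bar> \<le> d n" if "l \<noteq> i" for l
      using that dy component_le_norm_cart[of "y - p n" l] by (simp add: y_def dist_norm)
    then have "(\<chi> l. if l = i then -1/2 else p n $ l - d n) $ l \<le> x $ l
        \<and> x $ l \<le> (\<chi> l. if l = i then 1/2 else p n $ l + d n) $ l" for l
      using x by (cases "l = i") (auto simp: mem_box_cart abs_le_iff algebra_simps less_imp_le)
    then have "x \<in> Q n"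
      unfolding Q_def mem_box_cart by blast
    then show "x \<in> (\<Union>n. Q n)" by blast
  qed
  have "1 = emeasure lborel (box (\<chi> _. -1/2) (\<chi> _. 1/2) :: (real^3) set)"
  proof -
    have "cbox (\<chi> _. -1/2) (\<chi> _. 1/2) \<noteq> ({} :: (real^3) set)"
      by (simp add: interval_ne_empty_cart)
    then have "measure lebesgue (cbox (\<chi> _. -1/2) (\<chi> _. 1/2) :: (real^3) set) = 1"
      by (simp add: content_cbox_cart)
    moreover have "emeasure lborel (cbox (\<chi> _. -1/2) (\<chi> _. 1/2) :: (real^3) set) < \<infinity>"
      by (rule emeasure_lborel_cbox_finite)
    ultimately have "emeasure lborel (cbox (\<chi> _. -1/2) (\<chi> _. 1/2) :: (real^3) set) = 1"
      using emeasure_eq_ennreal_measure[of lborel "cbox (\<chi> _. -1/2) (\<chi> _. 1/2) :: (real^3) set"]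
      by (simp add: less_top)
    then show ?thesis
      by (simp only: emeasure_lborel_box_eq emeasure_lborel_cbox_eq)
  qed
  also have "\<dots> \<le> emeasure lborel (\<Union>n. Q n)"
    using cov by (intro emeasure_mono) (auto simp: Q_def)
  also have "\<dots> \<le> (\<Sum>n. emeasure lborel (Q n))"
    by (intro emeasure_subadditive_countably) (auto simp: Q_def)
  also have "\<dots> = (\<Sum>n. ennreal (16 / pi) * hausdorff_weight 2 (E n))"
  proof (rule suminf_cong)
    fix n
    have "4 * (d n)^2 = (16 / pi) * (unit_ball_vol 2 * (d n / 2) powr 2)"
      using d[of n] by (simp add: unit_ball_vol_2 powr_numeral field_simps power2_eq_square)
    then show "emeasure lborel (Q n) = ennreal (16 / pi) * hausdorff_weight 2 (E n)"
      by (simp add: vol hausdorff_weight_def d_def ennreal_mult[symmetric])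
  qed
  also have "\<dots> = ennreal (16 / pi) * (\<Sum>n. hausdorff_weight 2 (E n))" by simp
  finally have "ennreal (pi / 16) * 1 \<le> ennreal (pi / 16) * (ennreal (16 / pi) * (\<Sum>n. hausdorff_weight 2 (E n)))"
    by (rule mult_left_mono) simp
  then show "ennreal (pi / 16) \<le> (\<Sum>n. hausdorff_weight 2 (E n))"
    by (simp add: mult.assoc[symmetric] ennreal_mult[symmetric])
qed

lemma hausdorff_outer_open_face_pos: "0 < hausdorff_outer 2 (open_face i a)"
proof -
  have "0 < ennreal (pi / 16)" by simp
  also have "\<dots> \<le> hausdorff_pre 2 1 (open_face i a)" by (rule hausdorff_pre_open_face_ge)
  also have "\<dots> \<le> hausdorff_outer 2 (open_face i a)" by (rule hausdorff_pre_le_outer) simp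
  finally show ?thesis .
qed

lemma unit_cube_eq_box: "unit_cube = box (\<chi> _. -1/2) (\<chi> _. 1/2)"
  by (rule set_eqI) (simp only: unit_cube_def mem_Collect_eq mem_box_cart vec_lambda_beta)

lemma closure_unit_cube: "closure unit_cube = {w. \<forall>i. \<bar>w $ i\<bar> \<le> 1/2}"
proof -
  have "0 \<in> unit_cube" by (simp add: unit_cube_def)
  then have "unit_cube \<noteq> {}" by blast
  then have "closure unit_cube = cbox (\<chi> _. -1/2) (\<chi> _. 1/2)"
    unfolding unit_cube_eq_box by (rule closure_box)
  then show ?thesis
    by (auto simp only: mem_centred_cbox)
qed

lemma frontier_unit_cube:
  "frontier unit_cube = {w. (\<forall>i. \<bar>w $ i\<bar> \<le> 1/2) \<and> (\<exists>i. \<bar>w $ i\<bar> = 1/2)}"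
proof -
  have int: "interior unit_cube = {w. \<forall>i. \<bar>w $ i\<bar> < 1/2}"
    unfolding unit_cube_eq_box interior_open[OF open_box]
    by (auto simp only: mem_centred_box)
  show ?thesis
    unfolding frontier_def closure_unit_cube int by (auto simp: less_le)
qed

lemma frontier_unit_cube_faces: "frontier unit_cube = (\<Union>i. face i (-1/2) \<union> face i (1/2))"
proof (rule set_eqI)
  fix w :: "real^3"
  have half: "(\<bar>t\<bar> = 1/2) = (t = -1/2 \<or> t = 1/2)" for t :: real by arith
  have "w \<in> frontier unit_cube \<longleftrightarrow> (\<forall>l. \<bar>w $ l\<bar> \<le> 1/2) \<and> (\<exists>i. w $ i = -1/2 \<or> w $ i = 1/2)"
    by (simp only: frontier_unit_cube mem_Collect_eq half)
  also have "\<dots> \<longleftrightarrow> w \<in> (\<Union>i. face i (-1/2) \<union> face i (1/2))"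
    by (simp only: UN_iff Un_iff face_def mem_Collect_eq UNIV_I) blast
  finally show "w \<in> frontier unit_cube \<longleftrightarrow> w \<in> (\<Union>i. face i (-1/2) \<union> face i (1/2))" .
qed

lemma open_face_subset_frontier:
  assumes "\<bar>a\<bar> = 1/2"
  shows "open_face i a \<subseteq> frontier unit_cube"
proof
  fix w assume "w \<in> open_face i a"
  then have wi: "\<bar>w $ i\<bar> = 1/2" and wj: "\<And>j. j \<noteq> i \<Longrightarrow> \<bar>w $ j\<bar> < 1/2"
    using assms unfolding open_face_def by blast+
  have "\<bar>w $ l\<bar> \<le> 1/2" for l
    using wi wj[of l] by (cases "l = i") simp_all
  then show "w \<in> frontier unit_cube"
    using wi unfolding frontier_unit_cube by blast
qed

lemma hausdorff_outer_frontier_finite: "hausdorff_outer 2 (frontier unit_cube) < top"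
proof -
  let ?H = "hausdorff_measure 2 :: (real^3) measure"
  have S: "A \<in> sets ?H" if "closed A" for A
    using that by (intro borel_sets_hausdorff_measure borel_closed) simp
  have cl: "closed (face i a)" for i a
    unfolding face_def
    by (intro closed_Collect_conj closed_Collect_all closed_Collect_eq closed_Collect_le continuous_intros)
  have face: "emeasure ?H (face i (-1/2) \<union> face i (1/2)) < top" for i
  proof -
    have "emeasure ?H (face i (-1/2) \<union> face i (1/2))
        \<le> emeasure ?H (face i (-1/2)) + emeasure ?H (face i (1/2))"
      using S cl by (intro emeasure_subadditive) auto
    also have "\<dots> < top"
      using hausdorff_outer_face_finite[of i "-1/2"] hausdorff_outer_face_finite[of i "1/2"] S[OF cl]
      by (simp add: emeasure_hausdorff_measure)
    finally show ?thesis .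
  qed
  have "emeasure ?H (frontier unit_cube) \<le> (\<Sum>i\<in>UNIV. emeasure ?H (face i (-1/2) \<union> face i (1/2)))"
    unfolding frontier_unit_cube_faces using S cl by (intro emeasure_subadditive_finite) auto
  also have "\<dots> < top"
    using face by (subst ennreal_sum_less_top) auto
  finally show ?thesis
    using S[of "frontier unit_cube"] by (simp add: emeasure_hausdorff_measure)
qed

section \<open>The area measure on the boundary of the unit cube\<close>

text \<open>The Hausdorff measure on the surface of the cube, as a finite measure on the Borel sets: this is
  the form in which Fubini's theorem applies.\<close>

definition cube_area :: "(real^3) measure" where
  "cube_area = distr (restrict_space (hausdorff_measure 2) (frontier unit_cube)) borel (\<lambda>w. w)"

lemma sets_cube_area [simp, measurable_cong]: "sets cube_area = sets borel"
  and space_cube_area [simp]: "space cube_area = UNIV"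
  by (simp_all add: cube_area_def)

lemma borel_subset_hausdorff:
  "0 \<le> s \<Longrightarrow> f \<in> measurable borel M \<Longrightarrow> f \<in> measurable (hausdorff_measure s) M"
  by (auto simp: measurable_def borel_sets_hausdorff_measure)

lemma frontier_cube_in_sets: "frontier unit_cube \<in> sets (hausdorff_measure 2 :: (real^3) measure)"
  by (intro borel_sets_hausdorff_measure borel_closed) simp_all

lemma id_measurable_frontier_cube:
  "(\<lambda>w. w) \<in> measurable (restrict_space (hausdorff_measure 2) (frontier unit_cube)) (borel :: (real^3) measure)"
  by (intro measurable_restrict_space1 borel_subset_hausdorff) simp_all

lemma emeasure_cube_area:
  assumes "A \<in> sets borel"
  shows "emeasure cube_area A = hausdorff_outer 2 (A \<inter> frontier unit_cube)"
proof -
  have A: "A \<in> sets (hausdorff_measure 2)"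
    using assms by (intro borel_sets_hausdorff_measure) simp_all
  have "emeasure cube_area A = emeasure (restrict_space (hausdorff_measure 2) (frontier unit_cube)) (A \<inter> frontier unit_cube)"
    unfolding cube_area_def
    by (subst emeasure_distr[OF id_measurable_frontier_cube assms]) (simp add: space_restrict_space)
  also have "\<dots> = hausdorff_outer 2 (A \<inter> frontier unit_cube)"
    using frontier_cube_in_sets A
    by (subst emeasure_restrict_space) (auto intro!: emeasure_hausdorff_measure)
  finally show ?thesis .
qed

lemma finite_measure_cube_area: "finite_measure cube_area"
  using hausdorff_outer_frontier_finite
  by (intro finite_measureI) (simp add: emeasure_cube_area less_top)

lemma integral_cube_area:
  fixes g :: "real^3 \<Rightarrow> real"
  assumes "g \<in> borel_measurable borel"
  shows "integral\<^sup>L cube_area g = (LINT w:frontier unit_cube|hausdorff_measure 2. g w)"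
  unfolding cube_area_def set_lebesgue_integral_def
  using frontier_cube_in_sets
  by (subst integral_distr[OF id_measurable_frontier_cube assms]) (simp add: integral_restrict_space)

definition in_face_interior :: "3 \<Rightarrow> real^3 \<Rightarrow> bool" where
  "in_face_interior i w \<longleftrightarrow> \<bar>w $ i\<bar> = 1/2 \<and> (\<forall>j. j \<noteq> i \<longrightarrow> \<bar>w $ j\<bar> < 1/2)"

text \<open>The outward normal written out on the open faces and set to zero on the edges.\<close>

definition face_normal :: "real^3 \<Rightarrow> real^3" where
  "face_normal w = (\<chi> i. if in_face_interior i w then sgn (w $ i) else 0)"

lemma face_normal_eq:
  assumes "in_face_interior i w"
  shows "face_normal w = axis i (sgn (w $ i))"
proof -
  have "\<not> in_face_interior j w" if "j \<noteq> i" for j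
    using assms that unfolding in_face_interior_def by (metis less_irrefl)
  then show ?thesis
    using assms by (auto simp: face_normal_def axis_def vec_eq_iff)
qed

lemma norm_axis_eq_abs: "norm (axis i t :: real^'n) = \<bar>t\<bar>"
proof -
  have "axis i t = (t *\<^sub>R axis i 1 :: real^'n)" by (simp add: axis_def vec_eq_iff)
  then show ?thesis by simp
qed

lemma in_face_interior_measurable [measurable]: "Measurable.pred borel (in_face_interior i)"
  unfolding in_face_interior_def by measurable

lemma norm_face_normal_le: "norm (face_normal w) \<le> 1"
proof (cases "\<exists>i. in_face_interior i w")
  case True
  then obtain i where "in_face_interior i w" ..
  then show ?thesis
    by (simp add: face_normal_eq norm_axis_eq_abs sgn_if)
next
  case False
  then have "face_normal w = 0" by (simp add: face_normal_def vec_eq_iff)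
  then show ?thesis by simp
qed

lemma face_normal_nth_measurable: "(\<lambda>w. face_normal w $ i) \<in> borel_measurable borel"
  unfolding face_normal_def by (simp, measurable)

lemma face_normal_measurable [measurable]: "face_normal \<in> borel_measurable borel"
proof -
  show ?thesis
    using face_normal_nth_measurable by (subst borel_measurable_euclidean_space) (auto simp: Basis_vec_def inner_axis)
qed

definition cube_edges :: "(real^3) set" where
  "cube_edges = {w \<in> frontier unit_cube. \<forall>i. \<not> in_face_interior i w}"

text \<open>Off the open faces, two different coordinates have modulus \<open>1/2\<close>.\<close>

lemma hausdorff_outer_cube_edges: "hausdorff_outer 2 cube_edges = 0"
proof -
  define E where "E = (\<lambda>(i, j, a, b). face i a \<inter> face j b)"
  define I :: "(3 \<times> 3 \<times> real \<times> real) set" where "I = {(i, j, a, b). i \<noteq> j \<and> a \<in> {-1/2, 1/2} \<and> b \<in> {-1/2, 1/2}}"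
  have "cube_edges \<subseteq> (\<Union>k\<in>I. E k)"
  proof
    fix w assume w: "w \<in> cube_edges"
    then obtain i where le: "\<And>l. \<bar>w $ l\<bar> \<le> 1/2" and i: "\<bar>w $ i\<bar> = 1/2" and ni: "\<not> in_face_interior i w"
      unfolding cube_edges_def frontier_unit_cube by blast
    then obtain j where j: "j \<noteq> i" "\<not> \<bar>w $ j\<bar> < 1/2"
      unfolding in_face_interior_def by blast
    then have j2: "\<bar>w $ j\<bar> = 1/2" using le[of j] by simp
    have "(i, j, w $ i, w $ j) \<in> I"
      using i j j2 unfolding I_def by (auto simp: abs_if split: if_splits)
    moreover have "w \<in> E (i, j, w $ i, w $ j)"
      using le unfolding E_def face_def by auto
    ultimately show "w \<in> (\<Union>k\<in>I. E k)" by blast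
  qed
  moreover have "(\<Union>k\<in>I. E k) \<in> null_sets (hausdorff_measure 2)"
  proof (rule null_sets_UN')
    have "I \<subseteq> UNIV \<times> UNIV \<times> {-1/2, 1/2} \<times> {-1/2, 1/2}" by (auto simp: I_def)
    then show "countable I"
      by (rule countable_subset) (intro countable_finite finite_SigmaI, simp_all)
    show "E k \<in> null_sets (hausdorff_measure 2)" if "k \<in> I" for k
      using that hausdorff_outer_edge_null
      by (auto simp: I_def E_def intro!: hausdorff_null_in_sets[OF _ order_refl])
  qed
  then have "hausdorff_outer 2 (\<Union>k\<in>I. E k) = 0"
    by (metis emeasure_hausdorff_measure null_setsD1 null_setsD2)
  ultimately show ?thesis
    using hausdorff_outer_mono by (metis le_zero_eq)
qed

text \<open>The supporting inequality passes to the closed cube. Moving inside the face by \<open>\<plusminus>t\<close> in a direction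
  \<open>j \<noteq> i\<close> kills the component \<open>v $ j\<close>, and moving to the opposite face fixes the sign of \<open>v $ i\<close>.\<close>

lemma face_normal_unique:
  assumes w: "in_face_interior i w" and v: "norm v = 1" and le: "\<And>z. z \<in> unit_cube \<Longrightarrow> (z - w) \<bullet> v \<le> 0"
  shows "v = axis i (sgn (w $ i))"
proof -
  have wi: "\<bar>w $ i\<bar> = 1/2" and wj: "\<And>j. j \<noteq> i \<Longrightarrow> \<bar>w $ j\<bar> < 1/2"
    using w unfolding in_face_interior_def by blast+
  have "closure unit_cube \<subseteq> {z. (z - w) \<bullet> v \<le> 0}"
    using le by (intro closure_minimal closed_Collect_le continuous_intros) auto
  then have cl: "(z - w) \<bullet> v \<le> 0" if "\<And>l. \<bar>z $ l\<bar> \<le> 1/2" for z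
    using that unfolding closure_unit_cube by blast
  have move: "t * v $ j \<le> 0" if "\<bar>w $ j + t\<bar> \<le> 1/2" for j t
  proof -
    have "\<bar>(w + axis j t) $ l\<bar> \<le> 1/2" for l
      using that wi wj[of l] by (cases "l = j"; cases "l = i") (auto simp: axis_def less_imp_le)
    then have "((w + axis j t) - w) \<bullet> v \<le> 0" by (rule cl)
    then show ?thesis by (simp add: inner_commute inner_axis mult.commute)
  qed
  have vj: "v $ j = 0" if "j \<noteq> i" for j
  proof -
    define t where "t = 1/2 - \<bar>w $ j\<bar>"
    have t: "0 < t" using wj[OF that] by (simp add: t_def)
    have a: "\<bar>w $ j + t\<bar> \<le> 1/2" and b: "\<bar>w $ j + - t\<bar> \<le> 1/2"
      using wj[OF that] unfolding t_def by linarith+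
    show ?thesis using t move[OF a] move[OF b] by (simp add: mult_le_0_iff zero_le_mult_iff)
  qed
  then have veq: "v = axis i (v $ i)"
    by (auto simp: vec_eq_iff axis_def)
  then have "\<bar>v $ i\<bar> = 1"
    using v by (metis norm_axis_eq_abs)
  moreover have "(- 2 * w $ i) * v $ i \<le> 0"
    using wi by (intro move) (simp add: algebra_simps)
  ultimately have "v $ i = sgn (w $ i)"
    using wi by (auto simp: sgn_if abs_if mult_le_0_iff split: if_splits)
  with veq show ?thesis by simp
qed

lemma outward_normal_cube:
  assumes w: "in_face_interior i w" and r: "0 < r"
  shows "outward_normal (cube r x0) (r *\<^sub>R w + x0) = face_normal w"
proof -
  have le_iff: "(\<forall>z\<in>cube r x0. (z - (r *\<^sub>R w + x0)) \<bullet> v \<le> 0) \<longleftrightarrow> (\<forall>z\<in>unit_cube. (z - w) \<bullet> v \<le> 0)" for v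
  proof -
    have "((r *\<^sub>R z + x0) - (r *\<^sub>R w + x0)) \<bullet> v = r * ((z - w) \<bullet> v)" for z
      by (simp add: algebra_simps inner_diff_left)
    then show ?thesis using r by (simp add: cube_def mult_le_0_iff)
  qed
  have wi: "\<bar>w $ i\<bar> = 1/2"
    using w unfolding in_face_interior_def by blast
  have "(z - w) \<bullet> axis i (sgn (w $ i)) \<le> 0" if "z \<in> unit_cube" for z
  proof -
    have "-1/2 < z $ i" "z $ i < 1/2" using that unfolding unit_cube_def by blast+
    then show ?thesis using wi by (auto simp: inner_axis sgn_if abs_if split: if_splits)
  qed
  then show ?thesis
    unfolding outward_normal_def le_iff face_normal_eq[OF w] using face_normal_unique[OF w] wi
    by (intro the_equality) (auto simp: sgn_if norm_axis_eq_abs)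
qed

section \<open>Moments of the normal field\<close>

text \<open>The reflections and the transpositions of coordinates are isometries that preserve the surface of
  the cube. Together they determine the moments of the normal field up to one positive number.\<close>

lemma distr_cube_area_isometry:
  fixes f :: "real^3 \<Rightarrow> real^3"
  assumes f: "\<And>x y. dist (f x) (f y) = dist x y" "surj f" and S: "f ` frontier unit_cube = frontier unit_cube"
  shows "distr cube_area borel f = cube_area"
proof (rule measure_eqI)
  have "continuous_on UNIV f"
    by (intro lipschitz_on_continuous_on[of 1]) (auto intro: lipschitz_onI simp: f)
  then have fm: "f \<in> borel_measurable borel" by (rule borel_measurable_continuous_onI)
  have inj: "inj f" using f(1) by (auto intro!: injI) (metis dist_eq_0_iff)
  fix A assume "A \<in> sets (distr cube_area borel f)"
  then have A: "A \<in> sets borel" by simp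
  have "emeasure (distr cube_area borel f) A = emeasure cube_area (f -` A)"
    using fm A by (subst emeasure_distr) auto
  also have "\<dots> = hausdorff_outer 2 (f -` A \<inter> frontier unit_cube)"
    using measurable_sets[OF fm A] by (intro emeasure_cube_area) simp
  also have "\<dots> = hausdorff_outer 2 (f ` (f -` A \<inter> frontier unit_cube))"
    using f by (subst hausdorff_outer_similarity[of 2 1 f]) auto
  also have "f ` (f -` A \<inter> frontier unit_cube) = A \<inter> frontier unit_cube"
    using inj f(2) S by (auto simp: image_Int surj_image_vimage_eq)
  also have "hausdorff_outer 2 (A \<inter> frontier unit_cube) = emeasure cube_area A"
    using A by (simp add: emeasure_cube_area)
  finally show "emeasure (distr cube_area borel f) A = emeasure cube_area A" .
qed simp

definition flip :: "3 \<Rightarrow> real^3 \<Rightarrow> real^3" where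
  "flip i w = (\<chi> k. if k = i then - w $ k else w $ k)"

definition swap :: "3 \<Rightarrow> 3 \<Rightarrow> real^3 \<Rightarrow> real^3" where
  "swap i j w = (\<chi> k. w $ Transposition.transpose i j k)"

lemma distr_cube_area_flip: "distr cube_area borel (flip i) = cube_area"
proof (rule distr_cube_area_isometry)
  have inv: "flip i (flip i w) = w" for w by (simp add: flip_def vec_eq_iff)
  show "dist (flip i x) (flip i y) = dist x y" for x y
    unfolding dist_vec_def L2_set_def
    by (rule arg_cong[where f = sqrt]) (auto simp: flip_def dist_real_def power2_commute intro!: sum.cong)
  show "surj (flip i)" by (rule surjI[of _ "flip i"]) (rule inv)
  have "\<bar>flip i w $ k\<bar> = \<bar>w $ k\<bar>" for w k by (simp add: flip_def)
  then have sub: "flip i ` frontier unit_cube \<subseteq> frontier unit_cube"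
    unfolding frontier_unit_cube by auto
  then show "flip i ` frontier unit_cube = frontier unit_cube"
    using inv by (metis (no_types, lifting) image_eqI image_subset_iff subsetI subset_antisym)
qed

lemma distr_cube_area_swap: "distr cube_area borel (swap i j) = cube_area"
proof (rule distr_cube_area_isometry)
  have inv: "swap i j (swap i j w) = w" for w by (simp add: swap_def vec_eq_iff)
  show "dist (swap i j x) (swap i j y) = dist x y" for x y
    unfolding dist_vec_def L2_set_def
    by (rule arg_cong[where f = sqrt], rule sum.reindex_bij_betw[of "Transposition.transpose i j" UNIV UNIV "\<lambda>k. (dist (x $ k) (y $ k))\<^sup>2", symmetric, THEN trans[symmetric]])
       (auto simp: swap_def)
  show "surj (swap i j)" by (rule surjI[of _ "swap i j"]) (rule inv)
  have "swap i j w \<in> frontier unit_cube" if w: "w \<in> frontier unit_cube" for w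
  proof -
    obtain k where "\<bar>w $ k\<bar> = 1/2" using w unfolding frontier_unit_cube by blast
    then have "\<bar>swap i j w $ Transposition.transpose i j k\<bar> = 1/2" by (simp add: swap_def)
    moreover have "\<bar>swap i j w $ l\<bar> \<le> 1/2" for l
      using w unfolding frontier_unit_cube swap_def by simp
    ultimately show ?thesis unfolding frontier_unit_cube by blast
  qed
  then have sub: "swap i j ` frontier unit_cube \<subseteq> frontier unit_cube" by blast
  then show "swap i j ` frontier unit_cube = frontier unit_cube"
    using inv by (metis (no_types, lifting) image_eqI image_subset_iff subsetI subset_antisym)
qed

lemma flip_measurable [measurable]: "flip i \<in> borel_measurable borel"
  by (subst borel_measurable_euclidean_space) (auto simp: Basis_vec_def inner_axis flip_def)

lemma swap_measurable [measurable]: "swap i j \<in> borel_measurable borel"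
  by (subst borel_measurable_euclidean_space) (auto simp: Basis_vec_def inner_axis swap_def)

lemma integral_cube_area_flip:
  fixes g :: "real^3 \<Rightarrow> real"
  assumes "g \<in> borel_measurable borel"
  shows "(\<integral>w. g (flip i w) \<partial>cube_area) = integral\<^sup>L cube_area g"
  using integral_distr[of "flip i" cube_area borel g] assms by (simp add: distr_cube_area_flip)

lemma integral_cube_area_swap:
  fixes g :: "real^3 \<Rightarrow> real"
  assumes "g \<in> borel_measurable borel"
  shows "(\<integral>w. g (swap i j w) \<partial>cube_area) = integral\<^sup>L cube_area g"
  using integral_distr[of "swap i j" cube_area borel g] assms by (simp add: distr_cube_area_swap)

lemma face_normal_flip: "face_normal (flip i w) $ j = (if j = i then - face_normal w $ j else face_normal w $ j)"
proof -
  have "\<bar>flip i w $ k\<bar> = \<bar>w $ k\<bar>" for k by (simp add: flip_def)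
  then have "in_face_interior k (flip i w) = in_face_interior k w" for k
    by (simp only: in_face_interior_def)
  then show ?thesis by (simp add: face_normal_def flip_def sgn_minus)
qed

lemma face_normal_swap: "face_normal (swap i j w) $ i = face_normal w $ j"
proof -
  have "in_face_interior i (swap i j w) = in_face_interior j w"
  proof -
    have "(\<forall>l. l \<noteq> i \<longrightarrow> \<bar>w $ Transposition.transpose i j l\<bar> < 1/2) \<longleftrightarrow> (\<forall>l. l \<noteq> j \<longrightarrow> \<bar>w $ l\<bar> < 1/2)"
      by (metis transpose_apply_first transpose_apply_second transpose_involutory)
    then show ?thesis unfolding in_face_interior_def swap_def by simp
  qed
  then show ?thesis by (simp add: face_normal_def swap_def)
qed

lemma face_normal_moment_measurable [measurable]:
  "(\<lambda>w. face_normal w $ i * w $ j) \<in> borel_measurable borel"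
  using face_normal_nth_measurable by measurable

text \<open>The reflection in the coordinate \<open>i\<close> changes the sign of the integrand.\<close>

lemma integral_face_normal: "(\<integral>w. face_normal w $ i \<partial>cube_area) = 0"
  using integral_cube_area_flip[OF face_normal_nth_measurable, of i i] by (simp add: face_normal_flip)

text \<open>The reflection in the coordinate \<open>j\<close> changes the sign of the integrand.\<close>

lemma integral_face_normal_offdiag:
  assumes "i \<noteq> j"
  shows "(\<integral>w. face_normal w $ i * w $ j \<partial>cube_area) = 0"
proof -
  have "face_normal (flip j w) $ i * flip j w $ j = - (face_normal w $ i * w $ j)" for w
    using assms by (simp add: face_normal_flip) (simp add: flip_def)
  then show ?thesis
    using integral_cube_area_flip[OF face_normal_moment_measurable, of j i j] by simp
qed

lemma integral_face_normal_diag: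
  "(\<integral>w. face_normal w $ i * w $ i \<partial>cube_area) = (\<integral>w. face_normal w $ j * w $ j \<partial>cube_area)"
proof -
  have "swap i j w $ i = w $ j" for w by (simp add: swap_def)
  then show ?thesis
    using integral_cube_area_swap[OF face_normal_moment_measurable, of i j i i]
    by (simp add: face_normal_swap)
qed

text \<open>The integrand is \<open>1/2\<close> on the open faces orthogonal to the axis \<open>i\<close> and zero elsewhere.\<close>

lemma integral_face_normal_diag_pos: "0 < (\<integral>w. face_normal w $ i * w $ i \<partial>cube_area)"
proof -
  interpret finite_measure cube_area by (rule finite_measure_cube_area)
  have op: "open_face i (1/2) \<in> sets borel"
    unfolding open_face_def by measurable
  have "0 < emeasure cube_area (open_face i (1/2))"
    using hausdorff_outer_open_face_pos[of i "1/2"] open_face_subset_frontier[of "1/2" i] op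
    by (simp add: emeasure_cube_area Int_absorb2)
  then have "0 < 1/2 * measure cube_area (open_face i (1/2))"
    by (simp add: emeasure_eq_measure)
  also have "\<dots> = (\<integral>w. indicator (open_face i (1/2)) w * (1/2) \<partial>cube_area)"
    using op by simp
  also have "\<dots> \<le> (\<integral>w. face_normal w $ i * w $ i \<partial>cube_area)"
  proof (rule integral_mono)
    have half: "face_normal w $ i * w $ i = (if in_face_interior i w then 1/2 else 0)" for w
      by (auto simp: face_normal_def in_face_interior_def sgn_if abs_if split: if_splits)
    show "integrable cube_area (\<lambda>w. indicator (open_face i (1/2)) w * (1/2) :: real)"
      using op by (intro integrable_const_bound[where B = 1]) (auto simp: indicator_def)
    show "integrable cube_area (\<lambda>w. face_normal w $ i * w $ i)"
      using face_normal_moment_measurable[of i i]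
      by (intro integrable_const_bound[where B = 1]) (auto simp: half simp del: face_normal_moment_measurable)
    show "indicator (open_face i (1/2)) w * (1/2) \<le> face_normal w $ i * w $ i" for w
      unfolding half by (auto simp: indicator_def open_face_def in_face_interior_def)
  qed
  finally show ?thesis .
qed

section \<open>Fluxes as integrals over the unit cube\<close>

text \<open>The integrand \<open>f\<close> is a priori arbitrary: its measurability comes from completeness.\<close>

lemma integral_hausdorff_measure_cong:
  fixes f g :: "'a::metric_space \<Rightarrow> real"
  assumes s: "0 \<le> s" and g: "g \<in> borel_measurable borel" and N: "hausdorff_outer s N = 0"
    and eq: "\<And>y. y \<notin> N \<Longrightarrow> f y = g y"
  shows "integral\<^sup>L (hausdorff_measure s) f = integral\<^sup>L (hausdorff_measure s) g"
proof (rule integral_cong_AE)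
  have null: "A \<subseteq> N \<Longrightarrow> A \<in> null_sets (hausdorff_measure s)" for A
    by (rule hausdorff_null_in_sets[OF N])
  have gm: "g \<in> borel_measurable (hausdorff_measure s)"
    by (rule borel_subset_hausdorff[OF s g])
  show "f \<in> borel_measurable (hausdorff_measure s)"
  proof (rule measurableI)
    fix B :: "real set" assume B: "B \<in> sets borel"
    have "f -` B \<inter> space (hausdorff_measure s) = (f -` B \<inter> N) \<union> (g -` B \<inter> space (hausdorff_measure s) - N)"
      using eq by auto
    also have "\<dots> \<in> sets (hausdorff_measure s)"
      using null[of "f -` B \<inter> N"] null[of N] measurable_sets[OF gm B] by auto
    finally show "f -` B \<inter> space (hausdorff_measure s) \<in> sets (hausdorff_measure s)" .
  qed auto
  show "g \<in> borel_measurable (hausdorff_measure s)" by fact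
  show "AE y in hausdorff_measure s. f y = g y"
    using null[OF order_refl] eq by (intro AE_I'[of N]) auto
qed

lemma integral_hausdorff_measure_similarity:
  fixes f :: "'a::metric_space \<Rightarrow> 'a" and g :: "'a \<Rightarrow> real"
  assumes s: "0 \<le> s" and r: "0 < r" and f: "\<And>x y. dist (f x) (f y) = r * dist x y" and "surj f"
    and g: "g \<in> borel_measurable borel"
  shows "integral\<^sup>L (hausdorff_measure s) g = r powr s * (\<integral>x. g (f x) \<partial>hausdorff_measure s)"
proof -
  have "continuous_on UNIV f"
    using r by (intro lipschitz_on_continuous_on[of r]) (auto intro: lipschitz_onI simp: f)
  then have fm: "f \<in> borel_measurable borel" by (rule borel_measurable_continuous_onI)
  have fH: "f \<in> measurable (hausdorff_measure s) borel"
    by (rule borel_subset_hausdorff[OF s fm])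
  have idH: "(\<lambda>x. x) \<in> measurable (hausdorff_measure s) (borel :: 'a measure)"
    by (rule borel_subset_hausdorff[OF s]) simp
  have "distr (hausdorff_measure s) borel (\<lambda>x. x)
      = density (distr (hausdorff_measure s) borel f) (\<lambda>_. ennreal (r powr s))"
  proof (rule measure_eqI)
    fix A assume "A \<in> sets (distr (hausdorff_measure s) borel (\<lambda>x. x :: 'a))"
    then have A: "A \<in> sets borel" by simp
    have "f ` (f -` A) = A" using \<open>surj f\<close> by (simp add: surj_image_vimage_eq)
    then have "hausdorff_outer s A = ennreal (r powr s) * hausdorff_outer s (f -` A)"
      using hausdorff_outer_similarity[OF s r f \<open>surj f\<close>, of "f -` A"] by simp
    moreover have "f -` A \<in> sets borel" using measurable_sets[OF fm A] by simp
    ultimately show "emeasure (distr (hausdorff_measure s) borel (\<lambda>x. x)) A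
        = emeasure (density (distr (hausdorff_measure s) borel f) (\<lambda>_. ennreal (r powr s))) A"
      using A by (simp add: emeasure_density_const emeasure_distr[OF idH] emeasure_distr[OF fH]
          emeasure_hausdorff_measure borel_sets_hausdorff_measure[OF s])
  qed simp
  then have "integral\<^sup>L (distr (hausdorff_measure s) borel (\<lambda>x. x)) g
      = integral\<^sup>L (density (distr (hausdorff_measure s) borel f) (\<lambda>_. ennreal (r powr s))) g"
    by simp
  then show ?thesis
    using g by (simp add: integral_distr[OF idH] integral_density integral_distr[OF fH])
qed

lemma frontier_cube:
  assumes "0 < r"
  shows "frontier (cube r x0) = (\<lambda>w. r *\<^sub>R w + x0) ` frontier unit_cube"
proof -
  have eq: "(\<lambda>w. r *\<^sub>R w + x0) ` A = (+) x0 ` ((*\<^sub>R) r ` A)" for A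
    by (auto simp: image_image add.commute)
  have "frontier ((*\<^sub>R) r ` unit_cube) = (*\<^sub>R) r ` frontier unit_cube"
    using assms unfolding frontier_def by (simp add: closure_scaleR interior_injective_linear_image linear_scaleR image_set_diff inj_on_def)
  then show ?thesis
    unfolding cube_def eq frontier_translation by simp
qed

text \<open>The map \<open>T w = r w + x0\<close> multiplies areas by \<open>r\<^sup>2\<close> and transports normals. The exceptional set consists
  of the edges and of the points where \<open>X\<close> differs from its Borel representative \<open>Y\<close>.\<close>

lemma cube_flux_eq:
  fixes X Y :: "real^3 \<Rightarrow> real^3"
  assumes r: "0 < r" and Y: "Y \<in> borel_measurable borel"
    and XY: "hausdorff_outer 2 {w \<in> frontier unit_cube. X (r *\<^sub>R w + x0) \<noteq> Y (r *\<^sub>R w + x0)} = 0"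
  shows "cube_flux X x0 r = r\<^sup>2 * (\<integral>w. Y (r *\<^sub>R w + x0) \<bullet> face_normal w \<partial>cube_area)"
proof -
  define T where "T w = r *\<^sub>R w + x0" for w :: "real^3"
  define R where "R y = (1/r) *\<^sub>R (y - x0)" for y :: "real^3"
  have RT: "R (T w) = w" and TR: "T (R y) = y" for w y
    using r by (auto simp: R_def T_def)
  have T: "dist (T x) (T y) = r * dist x y" for x y
    using r by (simp add: T_def dist_norm scaleR_diff_right[symmetric])
  have surj: "surj T" using TR by (rule surjI)
  have Rm [measurable]: "R \<in> borel_measurable borel" and Tm [measurable]: "T \<in> borel_measurable borel"
    unfolding R_def T_def by measurable
  have S [measurable]: "frontier unit_cube \<in> sets borel" by (intro borel_closed) simp
  define B where "B = {w \<in> frontier unit_cube. X (T w) \<noteq> Y (T w)} \<union> cube_edges"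
  have "hausdorff_outer 2 B \<le> 0"
    using outer_measure_Un[OF outer_measure_space_hausdorff, of 2 "{w \<in> frontier unit_cube. X (T w) \<noteq> Y (T w)}" cube_edges]
      XY hausdorff_outer_cube_edges unfolding B_def T_def by simp
  then have N: "hausdorff_outer 2 (T ` B) = 0"
    using hausdorff_outer_similarity[of 2 r T, OF _ r T surj] by simp
  define g where "g y = indicator (frontier unit_cube) (R y) * (Y y \<bullet> face_normal (R y))" for y
  have g [measurable]: "g \<in> borel_measurable borel"
    unfolding g_def using Y by measurable
  have "cube_flux X x0 r = (\<integral>y. indicator (frontier (cube r x0)) y * (X y \<bullet> outward_normal (cube r x0) y) \<partial>hausdorff_measure 2)"
    unfolding cube_flux_def set_lebesgue_integral_def by simp
  also have "\<dots> = integral\<^sup>L (hausdorff_measure 2) g"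
  proof (rule integral_hausdorff_measure_cong[OF _ g N])
    fix y assume y: "y \<notin> T ` B"
    define w where "w = R y"
    have yw: "y = T w" by (simp add: w_def TR)
    have mem: "y \<in> frontier (cube r x0) \<longleftrightarrow> w \<in> frontier unit_cube"
      using RT TR unfolding frontier_cube[OF r] T_def[symmetric] w_def by (metis image_iff)
    show "indicator (frontier (cube r x0)) y * (X y \<bullet> outward_normal (cube r x0) y) = g y"
    proof (cases "w \<in> frontier unit_cube")
      case True
      have "w \<notin> B" using y yw by blast
      then have XYw: "X y = Y y" and "w \<notin> cube_edges" using True yw by (auto simp: B_def)
      then obtain i where "in_face_interior i w" using True by (auto simp: cube_edges_def)
      then have "outward_normal (cube r x0) y = face_normal w"
        unfolding yw T_def using r by (rule outward_normal_cube)
      then show ?thesis using True mem XYw by (simp add: g_def w_def[symmetric])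
    qed (simp add: mem g_def w_def[symmetric])
  qed simp
  also have "\<dots> = r powr 2 * (\<integral>w. g (T w) \<partial>hausdorff_measure 2)"
    by (rule integral_hausdorff_measure_similarity[OF _ r T surj g]) simp
  also have "(\<integral>w. g (T w) \<partial>hausdorff_measure 2) = (\<integral>w. Y (T w) \<bullet> face_normal w \<partial>cube_area)"
    using Y by (subst integral_cube_area) (simp_all add: g_def RT set_lebesgue_integral_def)
  finally show ?thesis using r by (simp add: T_def powr_numeral)
qed

section \<open>Lebesgue points on the line\<close>

text \<open>Let \<open>M\<close> be the measure with density \<open>g\<close> and choose by regularity an open \<open>U \<supseteq> A\<close> with \<open>M (U - A)\<close>
  small. Vitali's theorem covers almost all of the bad set by disjoint intervals \<open>I \<subseteq> U\<close> with \<open>M I \<ge> 2 e |I|\<close>.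
  Since \<open>g \<le> e\<close> on \<open>A\<close>, at most half of this mass lies in \<open>A\<close>; so the total length of the intervals is at most
  \<open>M (U - A) / e\<close>.\<close>

lemma negligible_large_averages:
  fixes g :: "real \<Rightarrow> real"
  assumes g: "integrable lborel g" "\<And>x. 0 \<le> g x" and A: "A \<in> sets borel"
    and e: "0 < e" and gA: "\<And>x. x \<in> A \<Longrightarrow> g x \<le> e"
  shows "negligible {x \<in> A. \<exists>\<^sub>F h in at_right 0. ennreal (2 * e * (2 * h)) < (\<integral>\<^sup>+s\<in>{x - h..x + h}. ennreal (g s) \<partial>lborel)}"
    (is "negligible ?E")
proof -
  have gm [measurable]: "g \<in> borel_measurable borel" using g(1) by auto
  define M where "M = density lborel (\<lambda>x. ennreal (g x))"
  have M: "emeasure M B = (\<integral>\<^sup>+s\<in>B. ennreal (g s) \<partial>lborel)" if "B \<in> sets borel" for B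
    using that by (simp add: M_def emeasure_density)
  have setsM: "sets M = sets borel" by (simp add: M_def)
  have finM: "emeasure M (space M) \<noteq> \<infinity>"
    using g by (simp add: M setsM[THEN sets_eq_imp_space_eq] nn_integral_eq_integral)
  show ?thesis
    unfolding negligible_outer_le
  proof (intro allI impI)
    fix d :: real assume d: "0 < d"
    obtain U where U: "open U" "A \<subseteq> U" "emeasure M U < emeasure M A + ennreal (e * d)"
    proof -
      have "emeasure M A < emeasure M A + ennreal (e * d)"
        using e d emeasure_space[of M A] finM by (auto simp: ennreal_zero_less_mult_iff less_top top_unique)
      also have "emeasure M A = (INF U\<in>{U. A \<subseteq> U \<and> open U}. emeasure M U)"
        using A by (intro outer_regular setsM finM) simp
      finally have "\<exists>U\<in>{U. A \<subseteq> U \<and> open U}. emeasure M U < emeasure M A + ennreal (e * d)"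
        using \<open>emeasure M A = (INF U\<in>{U. A \<subseteq> U \<and> open U}. emeasure M U)\<close> by (simp only: INF_less_iff)
      then show thesis using that by blast
    qed
    have UA: "emeasure M (U - A) \<le> ennreal (e * d)"
    proof -
      have "emeasure M A + emeasure M (U - A) = emeasure M U"
        using A U by (subst plus_emeasure) (auto simp: setsM intro!: arg_cong[where f = "emeasure M"])
      then have "emeasure M A + emeasure M (U - A) \<le> emeasure M A + ennreal (e * d)"
        using U(3) by simp
      moreover have "emeasure M A < top"
        using emeasure_space[of M A] finM by (auto simp: less_top top_unique)
      ultimately show ?thesis by (auto simp: ennreal_add_left_cancel_le)
    qed
    define K where "K = {(x, h). 0 < h \<and> cball x h \<subseteq> U \<and> ennreal (2 * e * (2 * h)) \<le> emeasure M (cball x h)}"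
    obtain C where C: "countable C" "C \<subseteq> K" and
        disj: "pairwise (\<lambda>i j. disjnt (cball (fst i) (snd i)) (cball (fst j) (snd j))) C" and
        neg: "negligible (?E - (\<Union>i\<in>C. cball (fst i) (snd i)))"
    proof (rule Vitali_covering_theorem_cballs[of K snd ?E fst])
      show "0 < snd i" if "i \<in> K" for i using that by (auto simp: K_def)
      fix x k :: real assume x: "x \<in> ?E" and k: "0 < k"
      then obtain k' where k': "0 < k'" "cball x k' \<subseteq> U"
        using U open_contains_cball by (metis (no_types, lifting) mem_Collect_eq subsetD)
      have "eventually (\<lambda>h. h \<in> {0<..<min k k'}) (at_right (0::real))"
        using k k' by (intro eventually_at_right_real) simp
      then have "\<exists>\<^sub>F h in at_right 0. ennreal (2 * e * (2 * h)) < (\<integral>\<^sup>+s\<in>{x - h..x + h}. ennreal (g s) \<partial>lborel) \<and> h \<in> {0<..<min k k'}"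
        using x by (intro frequently_eventually_frequently) auto
      then obtain h where h: "ennreal (2 * e * (2 * h)) < (\<integral>\<^sup>+s\<in>{x - h..x + h}. ennreal (g s) \<partial>lborel)" "0 < h" "h < k" "h < k'"
        by (auto dest: frequently_ex)
      then have "(x, h) \<in> K"
        using k'(2) subset_cball[of h k' x] by (auto simp: K_def M cball_eq_atLeastAtMost)
      then show "\<exists>i. i \<in> K \<and> x \<in> cball (fst i) (snd i) \<and> snd i < k"
        using h by (intro exI[of _ "(x, h)"]) auto
    qed blast
    define V where "V = (\<Union>i\<in>C. cball (fst i) (snd i))"
    have V: "V \<in> sets borel"
      unfolding V_def using C(1) by (intro sets.countable_UN') auto
    have VU: "V \<subseteq> U"
      unfolding V_def using C(2) by (force simp: K_def)
    have dj: "disjoint_family_on (\<lambda>i. cball (fst i) (snd i)) C"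
      using disj by (auto simp: disjoint_family_on_def pairwise_def disjnt_def)
    have "ennreal (2 * e) * emeasure lborel V = (\<integral>\<^sup>+i. ennreal (2 * e) * emeasure lborel (cball (fst i) (snd i)) \<partial>count_space C)"
      unfolding V_def using C(1) dj by (subst emeasure_UN_countable) (auto simp: nn_integral_cmult)
    also have "\<dots> \<le> (\<integral>\<^sup>+i. emeasure M (cball (fst i) (snd i)) \<partial>count_space C)"
    proof (intro nn_integral_mono)
      fix i assume "i \<in> space (count_space C)"
      then have "i \<in> K" using C by auto
      then show "ennreal (2 * e) * emeasure lborel (cball (fst i) (snd i)) \<le> emeasure M (cball (fst i) (snd i))"
        using e by (auto simp: K_def cball_eq_atLeastAtMost ennreal_mult[symmetric] split_beta)
    qed
    also have "\<dots> = emeasure M V"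
      unfolding V_def using C(1) dj by (subst emeasure_UN_countable) (auto simp: setsM)
    finally have VM: "ennreal (2 * e) * emeasure lborel V \<le> emeasure M V" .
    have "emeasure M V \<le> emeasure M ((V \<inter> A) \<union> (U - A))"
      using V VU A U by (intro emeasure_mono) (auto simp: setsM)
    also have "\<dots> \<le> emeasure M (V \<inter> A) + emeasure M (U - A)"
      using V A U by (intro emeasure_subadditive) (auto simp: setsM)
    also have "emeasure M (V \<inter> A) \<le> (\<integral>\<^sup>+s\<in>V \<inter> A. ennreal e \<partial>lborel)"
      using V A gA by (subst M) (auto intro!: nn_integral_mono ennreal_leI simp: indicator_def)
    also have "\<dots> = ennreal e * emeasure lborel (V \<inter> A)"
      using V A by (subst nn_integral_cmult_indicator) auto
    also have "\<dots> \<le> ennreal e * emeasure lborel V"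
      using V A by (intro mult_left_mono emeasure_mono) auto
    finally have "emeasure M V \<le> ennreal e * emeasure lborel V + emeasure M (U - A)"
      by (simp add: add_right_mono)
    also have "\<dots> \<le> ennreal e * emeasure lborel V + ennreal (e * d)"
      by (intro add_left_mono UA)
    finally have main: "ennreal (2 * e) * emeasure lborel V \<le> ennreal e * emeasure lborel V + ennreal (e * d)"
      by (rule order_trans[OF VM])
    have "emeasure M V < top"
      using emeasure_space[of M V] finM by (auto simp: less_top top_unique)
    then have "ennreal (2 * e) * emeasure lborel V < top"
      by (rule order.strict_trans1[OF VM])
    then have "emeasure lborel V \<noteq> top"
      using e by (auto simp: ennreal_mult_top)
    then obtain v where v: "emeasure lborel V = ennreal v" "0 \<le> v"
      by (cases "emeasure lborel V") auto
    have "2 * e * v \<le> e * v + e * d"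
      using main e d v by (simp add: ennreal_mult[symmetric] ennreal_plus[symmetric] del: ennreal_plus)
    then have vd: "v \<le> d" using e by (simp add: distrib_left[symmetric] del: distrib_left)
    have Vl: "V \<in> lmeasurable"
      using V v by (auto simp: fmeasurable_def)
    have mV: "measure lebesgue V \<le> d"
      using V v vd by (simp add: measure_def)
    show "\<exists>T. ?E \<subseteq> T \<and> T \<in> lmeasurable \<and> measure lebesgue T \<le> d"
    proof (intro exI conjI)
      show "?E \<subseteq> V \<union> (?E - V)" by blast
      have n: "?E - V \<in> lmeasurable" "measure lebesgue (?E - V) = 0"
        using neg unfolding V_def[symmetric] negligible_iff_measure by auto
      show "V \<union> (?E - V) \<in> lmeasurable" using Vl n(1) by (rule fmeasurable.Un)
      show "measure lebesgue (V \<union> (?E - V)) \<le> d"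
        using measure_Un_le[OF fmeasurableD[OF Vl] fmeasurableD[OF n(1)]] n(2) mV by linarith
    qed
  qed
qed

text \<open>Lebesgue's theorem follows by applying the estimate on averages to \<open>|f - q|\<close> with rational \<open>q\<close> close to
  \<open>f x\<close>. The truncation to \<open>[-N, N]\<close> makes this function integrable.\<close>

lemma AE_lebesgue_point:
  fixes f :: "real \<Rightarrow> real"
  assumes f: "integrable lborel f"
  shows "AE x in lebesgue. lebesgue_point f x"
proof -
  have fm [measurable]: "f \<in> borel_measurable borel" using f by auto
  define g where "g q N s = \<bar>f s - q\<bar> * indicator {- real N..real N} s" for q s :: real and N :: nat
  define P where "P q e N x \<longleftrightarrow> (\<bar>f x - q\<bar> \<le> e \<longrightarrow>
      (\<forall>\<^sub>F h in at_right 0. (\<integral>\<^sup>+s\<in>{x - h..x + h}. ennreal (g q N s) \<partial>lborel) \<le> ennreal (2 * e * (2 * h))))"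
    for q e x :: real and N :: nat
  have gi: "integrable lborel (g q N)" for q N
  proof -
    have "integrable lborel (\<lambda>s. \<bar>f s\<bar> + \<bar>q\<bar> * indicator {- real N..real N} s)"
      using f by (intro Bochner_Integration.integrable_add integrable_abs integrable_mult_right) auto
    then show ?thesis
      unfolding g_def by (rule Bochner_Integration.integrable_bound) (auto simp: indicator_def)
  qed
  have "AE x in lebesgue. P q e N x" if e: "0 < e" for q e N
  proof -
    have gle: "g q N x \<le> e" if "x \<in> {x. \<bar>f x - q\<bar> \<le> e}" for x
      using that e by (auto simp: g_def indicator_def)
    have "negligible {x \<in> {x. \<bar>f x - q\<bar> \<le> e}. \<exists>\<^sub>F h in at_right 0.
        ennreal (2 * e * (2 * h)) < (\<integral>\<^sup>+s\<in>{x - h..x + h}. ennreal (g q N s) \<partial>lborel)}"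
      by (rule negligible_large_averages[OF gi _ _ e gle]) (auto simp: g_def)
    then show ?thesis
      unfolding negligible_iff_null_sets
      by (rule AE_I') (auto simp: P_def frequently_def not_less)
  qed
  then have "AE x in lebesgue. \<forall>q\<in>\<rat>. \<forall>n N. P q (1 / real (Suc n)) N x"
    by (subst AE_ball_countable) (auto simp: AE_all_countable countable_rat)
  then show ?thesis
  proof (rule AE_mp, intro AE_I2 impI)
    fix x assume P: "\<forall>q\<in>\<rat>. \<forall>n N. P q (1 / real (Suc n)) N x"
    show "lebesgue_point f x"
      unfolding lebesgue_point_def
    proof (rule order_tendstoI)
      fix a :: ennreal assume "0 < a"
      obtain b where b: "0 < b" "ennreal b < a"
      proof (cases a)
        case (real r)
        then show ?thesis using \<open>0 < a\<close> that[of "r / 2"] by (auto simp: ennreal_less_iff)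
      next
        case top
        then show ?thesis using that[of 1] by simp
      qed
      obtain n where n: "1 / real (Suc n) < b / 3"
        using b nat_approx_posE[of "b / 3"] by auto
      define e where "e = 1 / real (Suc n)"
      have e: "0 < e" "3 * e < b" using n by (auto simp: e_def)
      \<comment> \<open>Then \<open>|f s - f x| \<le> |f s - q| + e\<close>, and the averages of \<open>|f - q|\<close> are eventually at most \<open>2 e\<close>.\<close>
      obtain q where q: "q \<in> \<rat>" "f x < q" "q < f x + e"
        using Rats_dense_in_real[of "f x" "f x + e"] e by auto
      obtain N :: nat where N: "\<bar>x\<bar> + 1 < real N"
        using reals_Archimedean2 by blast
      have "P q e N x" using P q by (simp add: e_def)
      then have "\<forall>\<^sub>F h in at_right 0. (\<integral>\<^sup>+s\<in>{x - h..x + h}. ennreal (g q N s) \<partial>lborel) \<le> ennreal (2 * e * (2 * h))"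
        using q by (simp add: P_def)
      moreover have "eventually (\<lambda>h. h \<in> {0<..<1}) (at_right (0::real))"
        by (intro eventually_at_right_real) simp
      ultimately show "\<forall>\<^sub>F h in at_right 0. (\<integral>\<^sup>+s\<in>{x - h..x + h}. ennreal \<bar>f s - f x\<bar> \<partial>lebesgue) / ennreal (2 * h) < a"
      proof eventually_elim
        case (elim h)
        then have h: "0 < h" "h < 1" by auto
        have "(\<integral>\<^sup>+s\<in>{x - h..x + h}. ennreal \<bar>f s - f x\<bar> \<partial>lebesgue)
            \<le> (\<integral>\<^sup>+s. ennreal (g q N s) * indicator {x - h..x + h} s + ennreal e * indicator {x - h..x + h} s \<partial>lborel)"
          unfolding nn_integral_completion
        proof (intro nn_integral_mono)
          fix s
          show "ennreal \<bar>f s - f x\<bar> * indicator {x - h..x + h} s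
              \<le> ennreal (g q N s) * indicator {x - h..x + h} s + ennreal e * indicator {x - h..x + h} s"
          proof (cases "s \<in> {x - h..x + h}")
            case True
            then have "g q N s = \<bar>f s - q\<bar>" using N h by (auto simp: g_def indicator_def abs_le_iff)
            then show ?thesis
              using True q e by (auto simp: ennreal_plus[symmetric] simp del: ennreal_plus intro!: ennreal_leI)
          qed simp
        qed
        also have "\<dots> = (\<integral>\<^sup>+s\<in>{x - h..x + h}. ennreal (g q N s) \<partial>lborel) + ennreal e * ennreal (2 * h)"
          using h by (subst nn_integral_add) (auto simp: g_def nn_integral_cmult_indicator)
        also have "\<dots> \<le> ennreal (2 * e * (2 * h)) + ennreal e * ennreal (2 * h)"
          using elim by (intro add_right_mono) auto
        also have "\<dots> = ennreal (3 * e) * ennreal (2 * h)"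
          using e h by (simp add: ennreal_mult[symmetric] ennreal_plus[symmetric] algebra_simps del: ennreal_plus)
        finally have "(\<integral>\<^sup>+s\<in>{x - h..x + h}. ennreal \<bar>f s - f x\<bar> \<partial>lebesgue) / ennreal (2 * h) \<le> ennreal (3 * e)"
          using h by (intro divide_le_posI_ennreal) (simp_all add: mult.commute)
        also have "\<dots> < ennreal b" using e by (intro ennreal_lessI) auto
        also note b(2)
        finally show ?case .
      qed
    qed simp
  qed
qed

section \<open>Fluxes through almost every cube\<close>

interpretation cube_area: finite_measure cube_area
  by (rule finite_measure_cube_area)

interpretation space_cube: pair_sigma_finite "lborel :: (real^3) measure" cube_area ..

lemma shear_measurable [measurable]:
  "(\<lambda>(x, w). (r *\<^sub>R w + x, w)) \<in> measurable (lborel \<Otimes>\<^sub>M cube_area) (lborel \<Otimes>\<^sub>M cube_area)"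
  by measurable

lemma emeasure_lborel_translate:
  fixes c :: "'a::euclidean_space"
  assumes "A \<in> sets borel"
  shows "emeasure lborel {x. c + x \<in> A} = emeasure lborel A"
proof -
  have "emeasure lborel A = emeasure (distr lborel borel ((+) c)) A"
    by (simp add: lborel_distr_plus)
  also have "\<dots> = emeasure lborel {x. c + x \<in> A}"
    using assms by (subst emeasure_distr) (auto simp: vimage_def)
  finally show ?thesis ..
qed

text \<open>For fixed \<open>w\<close> the map is a translation in \<open>x\<close>. This invariance is what turns integrals over all
  cubes of size \<open>r\<close> into integrals over space.\<close>

lemma distr_shear:
  "distr (lborel \<Otimes>\<^sub>M cube_area) (lborel \<Otimes>\<^sub>M cube_area) (\<lambda>(x, w). (r *\<^sub>R w + x, w)) = lborel \<Otimes>\<^sub>M cube_area"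
    (is "?D = ?P")
proof (rule pair_measure_eqI[symmetric])
  show "sigma_finite_measure (lborel :: (real^3) measure)" "sigma_finite_measure cube_area" ..
  show "sets (lborel \<Otimes>\<^sub>M cube_area) = sets ?D" by simp
  fix A :: "(real^3) set" and B assume A: "A \<in> sets lborel" and B: "B \<in> sets cube_area"
  have AB: "A \<times> B \<in> sets ?P" using A B by simp
  have "emeasure ?D (A \<times> B) = emeasure ?P ((\<lambda>(x, w). (r *\<^sub>R w + x, w)) -` (A \<times> B) \<inter> space ?P)"
    by (rule emeasure_distr[OF shear_measurable AB])
  also have "\<dots> = (\<integral>\<^sup>+w. emeasure lborel ((\<lambda>x. (x, w)) -` ((\<lambda>(x, w). (r *\<^sub>R w + x, w)) -` (A \<times> B) \<inter> space ?P)) \<partial>cube_area)"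
    by (rule space_cube.emeasure_pair_measure_alt2[OF measurable_sets[OF shear_measurable AB]])
  also have "\<dots> = (\<integral>\<^sup>+w. emeasure lborel A * indicator B w \<partial>cube_area)"
  proof (rule nn_integral_cong)
    fix w
    have "(\<lambda>x. (x, w)) -` ((\<lambda>(x, w). (r *\<^sub>R w + x, w)) -` (A \<times> B) \<inter> space ?P)
        = (if w \<in> B then {x. r *\<^sub>R w + x \<in> A} else {})"
      by (auto simp: space_pair_measure)
    then show "emeasure lborel ((\<lambda>x. (x, w)) -` ((\<lambda>(x, w). (r *\<^sub>R w + x, w)) -` (A \<times> B) \<inter> space ?P))
        = emeasure lborel A * indicator B w"
      using A by (simp add: emeasure_lborel_translate)
  qed
  also have "\<dots> = emeasure lborel A * emeasure cube_area B"
    using B by (subst nn_integral_cmult) auto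
  finally show "emeasure lborel A * emeasure cube_area B = emeasure ?D (A \<times> B)" ..
qed

lemma nn_integral_shear:
  assumes h [measurable]: "h \<in> borel_measurable borel"
  shows "(\<integral>\<^sup>+x. \<integral>\<^sup>+w. h (r *\<^sub>R w + x) \<partial>cube_area \<partial>lborel) = (\<integral>\<^sup>+z. h z \<partial>lborel) * emeasure cube_area UNIV"
proof -
  have "(\<integral>\<^sup>+x. \<integral>\<^sup>+w. h (r *\<^sub>R w + x) \<partial>cube_area \<partial>lborel) = (\<integral>\<^sup>+p. h (r *\<^sub>R snd p + fst p) \<partial>(lborel \<Otimes>\<^sub>M cube_area))"
    by (subst cube_area.nn_integral_fst[symmetric]) simp_all
  also have "\<dots> = (\<integral>\<^sup>+p. h (fst p) \<partial>distr (lborel \<Otimes>\<^sub>M cube_area) (lborel \<Otimes>\<^sub>M cube_area) (\<lambda>(x, w). (r *\<^sub>R w + x, w)))"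
    by (subst nn_integral_distr) (auto simp: split_beta intro!: nn_integral_cong)
  also have "\<dots> = (\<integral>\<^sup>+p. h (fst p) \<partial>(lborel \<Otimes>\<^sub>M cube_area))"
    by (simp add: distr_shear)
  also have "\<dots> = (\<integral>\<^sup>+z. \<integral>\<^sup>+w. h z \<partial>cube_area \<partial>lborel)"
    by (subst cube_area.nn_integral_fst[symmetric]) simp_all
  also have "\<dots> = (\<integral>\<^sup>+z. h z \<partial>lborel) * emeasure cube_area UNIV"
    by (simp add: nn_integral_multc)
  finally show ?thesis .
qed

text \<open>The flux through the cube of size \<open>r\<close> centred at \<open>x\<close>, divided by \<open>r\<^sup>2\<close>.\<close>

definition mean_flux :: "(real^3 \<Rightarrow> real^3) \<Rightarrow> real^3 \<Rightarrow> real \<Rightarrow> real" where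
  "mean_flux Y x r = (\<integral>w. Y (r *\<^sub>R w + x) \<bullet> face_normal w \<partial>cube_area)"

lemma mean_flux_measurable:
  assumes Y [measurable]: "Y \<in> borel_measurable borel"
  shows "(\<lambda>(x, r). mean_flux Y x r) \<in> borel_measurable (lborel \<Otimes>\<^sub>M lborel)"
  unfolding mean_flux_def split_beta
  by (rule cube_area.borel_measurable_lebesgue_integral) measurable

lemma abs_mean_flux_le:
  "ennreal \<bar>mean_flux Y x r\<bar> \<le> (\<integral>\<^sup>+w. ennreal (norm (Y (r *\<^sub>R w + x))) \<partial>cube_area)"
proof (cases "integrable cube_area (\<lambda>w. Y (r *\<^sub>R w + x) \<bullet> face_normal w)")
  case True
  have "ennreal \<bar>mean_flux Y x r\<bar> \<le> (\<integral>\<^sup>+w. norm (Y (r *\<^sub>R w + x) \<bullet> face_normal w) \<partial>cube_area)"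
    using integral_norm_bound_ennreal[OF True] by (simp add: mean_flux_def)
  also have "\<dots> \<le> (\<integral>\<^sup>+w. ennreal (norm (Y (r *\<^sub>R w + x))) \<partial>cube_area)"
  proof (intro nn_integral_mono ennreal_leI)
    fix w
    have "norm (Y (r *\<^sub>R w + x) \<bullet> face_normal w) \<le> norm (Y (r *\<^sub>R w + x)) * norm (face_normal w)"
      using Cauchy_Schwarz_ineq2 by simp
    also have "\<dots> \<le> norm (Y (r *\<^sub>R w + x)) * 1"
      by (intro mult_left_mono norm_face_normal_le) simp
    finally show "norm (Y (r *\<^sub>R w + x) \<bullet> face_normal w) \<le> norm (Y (r *\<^sub>R w + x))" by simp
  qed
  finally show ?thesis .
qed (simp add: mean_flux_def not_integrable_integral_eq)

text \<open>For every single \<open>r\<close> the shear invariance gives the claim for almost every \<open>x\<close>; Fubini's theorem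
  exchanges the two quantifiers.\<close>

lemma AE_sphere_avoids_null:
  assumes N: "N \<in> null_sets (lborel :: (real^3) measure)"
  shows "AE x in lborel. AE r in (lborel :: real measure). emeasure cube_area {w. r *\<^sub>R w + x \<in> N} = 0"
proof -
  have [measurable]: "N \<in> sets borel" using N by auto
  have eq: "emeasure cube_area {w. r *\<^sub>R w + x \<in> N} = (\<integral>\<^sup>+w. indicator N (r *\<^sub>R w + x) \<partial>cube_area)" for r x
  proof -
    have "emeasure cube_area {w. r *\<^sub>R w + x \<in> N} = (\<integral>\<^sup>+w. indicator {w. r *\<^sub>R w + x \<in> N} w \<partial>cube_area)"
      by (rule nn_integral_indicator[symmetric]) measurable
    also have "\<dots> = (\<integral>\<^sup>+w. indicator N (r *\<^sub>R w + x) \<partial>cube_area)"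
      by (rule nn_integral_cong) (simp add: indicator_def)
    finally show ?thesis .
  qed
  have m: "(\<lambda>p. \<integral>\<^sup>+w. indicator N (snd p *\<^sub>R w + fst p) \<partial>cube_area) \<in> borel_measurable ((lborel :: (real^3) measure) \<Otimes>\<^sub>M (lborel :: real measure))"
    by measurable
  have "AE x in lborel. (\<integral>\<^sup>+w. indicator N (r *\<^sub>R w + x) \<partial>cube_area) = 0" for r
  proof (subst nn_integral_0_iff_AE[symmetric])
    have "(\<integral>\<^sup>+x. \<integral>\<^sup>+w. indicator N (r *\<^sub>R w + x) \<partial>cube_area \<partial>lborel) = emeasure lborel N * emeasure cube_area UNIV"
      by (subst nn_integral_shear) auto
    then show "(\<integral>\<^sup>+x. \<integral>\<^sup>+w. indicator N (r *\<^sub>R w + x) \<partial>cube_area \<partial>lborel) = 0"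
      using N by auto
  qed measurable
  then have "AE r in (lborel :: real measure). AE x in lborel. (\<integral>\<^sup>+w. indicator N (r *\<^sub>R w + x) \<partial>cube_area) = 0"
    by simp
  then show ?thesis
    unfolding eq by (subst lborel_pair.AE_commute) (use m in measurable)
qed

text \<open>By the shear invariance, the integral of \<open>|Y (r w + x)|\<close> over \<open>x\<close> and \<open>w\<close> is finite and the same for all
  \<open>r\<close>.\<close>

lemma AE_integrable_flux:
  assumes Y [measurable]: "Y \<in> borel_measurable borel" and Yi: "integrable lborel Y"
  shows "AE x in lborel. integrable lborel (\<lambda>r. indicator {0<..<1} r * (r\<^sup>2 * mean_flux Y x r))"
proof -
  let ?J = "\<lambda>x r. (\<integral>\<^sup>+w. ennreal (norm (Y (r *\<^sub>R w + x))) \<partial>cube_area) * indicator {0<..<1} r"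
  have fin: "(\<integral>\<^sup>+x. ennreal (norm (Y x)) \<partial>lborel) * emeasure cube_area UNIV < top"
  proof -
    have "(\<integral>\<^sup>+x. ennreal (norm (Y x)) \<partial>lborel) < top"
      using Yi by (simp add: integrable_iff_bounded)
    moreover have "emeasure cube_area UNIV < top"
      using cube_area.emeasure_finite[of UNIV] by (simp only: infinity_ennreal_def top.not_eq_extremum)
    ultimately show ?thesis by (simp add: ennreal_mult_less_top)
  qed
  have "(\<integral>\<^sup>+x. \<integral>\<^sup>+r. ?J x r \<partial>lborel \<partial>lborel) = (\<integral>\<^sup>+r. \<integral>\<^sup>+x. ?J x r \<partial>lborel \<partial>lborel)"
    by (rule lborel_pair.Fubini'[symmetric]) measurable
  also have "\<dots> = (\<integral>\<^sup>+r. ((\<integral>\<^sup>+x. ennreal (norm (Y x)) \<partial>lborel) * emeasure cube_area UNIV) * indicator {0<..<1 :: real} r \<partial>lborel)"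
    by (intro nn_integral_cong, subst nn_integral_multc) (simp_all add: nn_integral_shear[of "\<lambda>z. ennreal (norm (Y z))"])
  also have "\<dots> < top"
    using fin by (subst nn_integral_cmult) (simp_all add: ennreal_mult_less_top)
  finally have "AE x in lborel. (\<integral>\<^sup>+r. ?J x r \<partial>lborel) \<noteq> \<infinity>"
    by (intro nn_integral_PInf_AE) (auto simp: less_top)
  then show ?thesis
  proof (rule AE_mp, intro AE_I2 impI)
    fix x assume x: "(\<integral>\<^sup>+r. ?J x r \<partial>lborel) \<noteq> \<infinity>"
    show "integrable lborel (\<lambda>r. indicator {0<..<1} r * (r\<^sup>2 * mean_flux Y x r))"
    proof (rule integrableI_bounded)
      have "(\<lambda>r. mean_flux Y x r) \<in> borel_measurable lborel"
        using measurable_Pair2[OF mean_flux_measurable[OF Y], of x] by simp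
      then show "(\<lambda>r. indicator {0<..<1} r * (r\<^sup>2 * mean_flux Y x r)) \<in> borel_measurable lborel"
        by measurable
      have "(\<integral>\<^sup>+r. ennreal (norm (indicator {0<..<1} r * (r\<^sup>2 * mean_flux Y x r))) \<partial>lborel) \<le> (\<integral>\<^sup>+r. ?J x r \<partial>lborel)"
      proof (intro nn_integral_mono)
        fix r :: real
        show "ennreal (norm (indicator {0<..<1} r * (r\<^sup>2 * mean_flux Y x r))) \<le> ?J x r"
        proof (cases "r \<in> {0<..<1}")
          case True
          then have "r\<^sup>2 * \<bar>mean_flux Y x r\<bar> \<le> 1 * \<bar>mean_flux Y x r\<bar>"
            by (intro mult_right_mono) (auto simp: power_le_one)
          then have "ennreal (norm (indicator {0<..<1} r * (r\<^sup>2 * mean_flux Y x r))) \<le> ennreal \<bar>mean_flux Y x r\<bar>"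
            using True by (intro ennreal_leI) (simp add: abs_mult)
          also note abs_mean_flux_le
          finally show ?thesis using True by simp
        qed simp
      qed
      also have "\<dots> < \<infinity>" using x by (simp add: less_top)
      finally show "(\<integral>\<^sup>+r. ennreal (norm (indicator {0<..<1} r * (r\<^sup>2 * mean_flux Y x r))) \<partial>lborel) < \<infinity>" .
    qed
  qed
qed

lemma lebesgue_point_cong:
  assumes ae: "AE s in lebesgue. s \<in> {a<..<b} \<longrightarrow> F s = f s" and r: "a < r" "r < b" "F r = f r"
    and f: "lebesgue_point f r"
  shows "lebesgue_point F r"
  unfolding lebesgue_point_def
proof (rule Lim_transform_eventually[OF f[unfolded lebesgue_point_def]])
  have "eventually (\<lambda>h. h \<in> {0<..<min (r - a) (b - r)}) (at_right (0::real))"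
    using r by (intro eventually_at_right_real) simp
  then show "\<forall>\<^sub>F h in at_right 0. (\<integral>\<^sup>+s\<in>{r - h..r + h}. ennreal \<bar>f s - f r\<bar> \<partial>lebesgue) / ennreal (2 * h)
      = (\<integral>\<^sup>+s\<in>{r - h..r + h}. ennreal \<bar>F s - F r\<bar> \<partial>lebesgue) / ennreal (2 * h)"
  proof eventually_elim
    case (elim h)
    have "(\<integral>\<^sup>+s\<in>{r - h..r + h}. ennreal \<bar>f s - f r\<bar> \<partial>lebesgue) = (\<integral>\<^sup>+s\<in>{r - h..r + h}. ennreal \<bar>F s - F r\<bar> \<partial>lebesgue)"
      using ae by (intro nn_integral_cong_AE, eventually_elim) (use elim r(3) in \<open>auto simp: indicator_def\<close>)
    then show ?case by simp
  qed
qed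

lemma infdist_frontier_ball:
  fixes x :: "'a::euclidean_space"
  shows "1 - norm x \<le> infdist x (frontier (ball 0 1))"
proof -
  have "frontier (ball 0 1 :: 'a set) \<noteq> {}" by simp
  then show ?thesis
  proof (subst infdist_notempty, simp, intro cINF_greatest)
    fix y :: 'a assume "y \<in> frontier (ball 0 1)"
    then have "norm y = 1" by simp
    then show "1 - norm x \<le> dist x y"
      using norm_triangle_ineq2[of y x] by (simp add: dist_norm norm_minus_commute)
  qed
qed

lemma norm_frontier_unit_cube_le:
  assumes "w \<in> frontier unit_cube"
  shows "norm w \<le> sqrt 3 / 2"
proof -
  have "(norm w)\<^sup>2 = (\<Sum>i\<in>UNIV. (w $ i)\<^sup>2)"
    by (simp add: norm_vec_def L2_set_def sum_nonneg)
  also have "\<dots> \<le> (\<Sum>i\<in>(UNIV :: 3 set). (1/2)\<^sup>2)"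
    using assms unfolding frontier_unit_cube
    by (intro sum_mono) (auto simp: abs_square_le_1 power2_le_iff_abs_le)
  also have "\<dots> = (sqrt 3 / 2)\<^sup>2" by (simp add: power_divide)
  finally show ?thesis by (rule power2_le_imp_le) simp
qed

text \<open>For almost every centre \<open>x\<close> the flux agrees for almost every \<open>r\<close> with a Borel function of \<open>r\<close> that
  is integrable on the unit interval. Almost every \<open>r\<close> is then a Lebesgue point, where the hypothesis says that the flux
  is an integer. The factor \<open>sqrt 3\<close> keeps the cube inside the ball.\<close>

lemma AE_integer_flux:
  assumes X: "X \<in> Lp_integer_fluxes p" and Y: "Y \<in> borel_measurable borel" "integrable lborel Y"
    and N: "N \<in> null_sets lborel" and XY: "\<And>z. z \<in> ball 0 1 \<Longrightarrow> z \<notin> N \<Longrightarrow> X z = Y z"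
  shows "AE r in lborel. AE x in lborel.
    norm x + sqrt 3 * r < 1 \<longrightarrow> 0 < r \<longrightarrow> r\<^sup>2 * mean_flux Y x r \<in> \<int>"
proof -
  have [measurable]: "(\<lambda>p. mean_flux Y (fst p) (snd p)) \<in> borel_measurable ((lborel :: (real^3) measure) \<Otimes>\<^sub>M (lborel :: real measure))"
    using mean_flux_measurable[OF Y(1)] by (simp add: split_beta)
  have [measurable]: "\<int> \<in> sets (borel :: real measure)" by (simp add: borel_closed closed_Ints)
  have "AE x in lborel. AE r in lborel. norm x + sqrt 3 * r < 1 \<longrightarrow> 0 < r \<longrightarrow> r\<^sup>2 * mean_flux Y x r \<in> \<int>"
    using AE_sphere_avoids_null[OF N] AE_integrable_flux[OF Y]
  proof eventually_elim
    case (elim x)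
    define f where "f r = indicator {0<..<1} r * (r\<^sup>2 * mean_flux Y x r)" for r :: real
    define R where "R = (1 - norm x) / sqrt 3"
    show ?case
    proof (cases "x \<in> ball 0 1")
      case False
      then show ?thesis by (auto intro!: AE_I2 simp: dist_norm not_less) (smt (verit) mult_pos_pos real_sqrt_gt_zero)
    next
      case x: True
      have s3: "1 < sqrt (3::real)" by simp
      have "1 - norm x < 1 * sqrt 3" using norm_ge_zero[of x] s3 by linarith
      then have R1: "R < 1" unfolding R_def by (subst pos_divide_less_eq) simp_all
      have eq: "AE r in lebesgue. r \<in> {0<..<R} \<longrightarrow> cube_flux X x r = f r"
      proof -
        have "AE r in lebesgue. emeasure cube_area {w. r *\<^sub>R w + x \<in> N} = 0"
          using elim(1) by (rule AE_completion)
        then show ?thesis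
        proof (rule AE_mp, intro AE_I2 impI)
          fix r assume n: "emeasure cube_area {w. r *\<^sub>R w + x \<in> N} = 0" and r: "r \<in> {0<..<R}"
          have [measurable]: "N \<in> sets borel" using N by auto
          have "{w. r *\<^sub>R w + x \<in> N} \<in> sets borel" by measurable
          then have n0: "hausdorff_outer 2 ({w. r *\<^sub>R w + x \<in> N} \<inter> frontier unit_cube) = 0"
            using n by (simp add: emeasure_cube_area)
          have "X (r *\<^sub>R w + x) = Y (r *\<^sub>R w + x)" if w: "w \<in> frontier unit_cube" "r *\<^sub>R w + x \<notin> N" for w
          proof (rule XY[OF _ w(2)])
            have le1: "norm (r *\<^sub>R w + x) \<le> r * norm w + norm x"
              using norm_triangle_ineq[of "r *\<^sub>R w" x] r by simp
            have "norm w \<le> sqrt 3"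
              using norm_frontier_unit_cube_le[OF w(1)] real_sqrt_ge_zero[of 3] by linarith
            then have le2: "r * norm w \<le> r * sqrt 3"
              using r by (intro mult_left_mono) auto
            have "r * sqrt 3 < 1 - norm x"
              using r by (simp add: R_def pos_less_divide_eq)
            with le1 le2 have "norm (r *\<^sub>R w + x) < 1" by linarith
            then show "r *\<^sub>R w + x \<in> ball 0 1" by simp
          qed
          then have "{w \<in> frontier unit_cube. X (r *\<^sub>R w + x) \<noteq> Y (r *\<^sub>R w + x)}
              \<subseteq> {w. r *\<^sub>R w + x \<in> N} \<inter> frontier unit_cube" by blast
          from hausdorff_outer_mono[OF this, of 2]
          have "hausdorff_outer 2 {w \<in> frontier unit_cube. X (r *\<^sub>R w + x) \<noteq> Y (r *\<^sub>R w + x)} = 0"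
            unfolding n0 by simp
          then show "cube_flux X x r = f r"
            using cube_flux_eq[OF _ Y(1), of r X x] r R1 by (simp add: f_def mean_flux_def)
        qed
      qed
      have int: "AE r in lebesgue. r \<in> {0<..<R} \<longrightarrow> lebesgue_point (cube_flux X x) r \<longrightarrow> cube_flux X x r \<in> \<int>"
      proof -
        have "AE r in lebesgue. r \<in> {0<..<infdist x (frontier (ball 0 1)) / sqrt 3} \<longrightarrow>
            lebesgue_point (cube_flux X x) r \<longrightarrow> cube_flux X x r \<in> \<int>"
          using X x by (auto simp: Lp_integer_fluxes_def)
        then show ?thesis
        proof (rule AE_mp, intro AE_I2 impI)
          fix r assume r: "r \<in> {0<..<R}"
          have "R \<le> infdist x (frontier (ball 0 1)) / sqrt 3"
            unfolding R_def by (intro divide_right_mono infdist_frontier_ball) simp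
          then have "r \<in> {0<..<infdist x (frontier (ball 0 1)) / sqrt 3}" using r by auto
          then show "r \<in> {0<..<infdist x (frontier (ball 0 1)) / sqrt 3} \<longrightarrow>
              lebesgue_point (cube_flux X x) r \<longrightarrow> cube_flux X x r \<in> \<int> \<Longrightarrow>
              lebesgue_point (cube_flux X x) r \<Longrightarrow> cube_flux X x r \<in> \<int>" by blast
        qed
      qed
      have "AE r in lebesgue. lebesgue_point f r"
        using elim(2) unfolding f_def by (rule AE_lebesgue_point)
      with eq int have "AE r in lebesgue. r \<in> {0<..<R} \<longrightarrow> f r \<in> \<int>"
      proof eventually_elim
        case (elim r)
        then show ?case
          using lebesgue_point_cong[OF eq, of r] by auto
      qed
      then have "AE r in lborel. r \<in> {0<..<R} \<longrightarrow> f r \<in> \<int>"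
        by (simp add: AE_completion_iff)
      then show ?thesis
      proof eventually_elim
        case (elim r)
        show ?case
        proof (intro impI)
          assume "norm x + sqrt 3 * r < 1" "0 < r"
          then have "r \<in> {0<..<R}" by (simp add: R_def pos_less_divide_eq mult.commute)
          then show "r\<^sup>2 * mean_flux Y x r \<in> \<int>" using elim R1 by (simp add: f_def)
        qed
      qed
    qed
  qed
  then show ?thesis
    by (subst (asm) lborel_pair.AE_commute) (measurable, assumption?)
qed

section \<open>Second moments and the scarcity of nonzero integer fluxes\<close>

text \<open>The normal field vanishes off the surface of the cube, where \<open>|w| \<le> sqrt 3 / 2\<close>.\<close>

lemma norm_face_normal_mult_le: "norm w * norm (face_normal w) \<le> 1"
proof (cases "\<exists>i. in_face_interior i w")
  case True
  then obtain i where i: "in_face_interior i w" ..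
  have "\<bar>w $ l\<bar> \<le> 1/2" for l
    using i unfolding in_face_interior_def by (cases "l = i") (auto simp: less_imp_le)
  then have "w \<in> frontier unit_cube"
    using i unfolding frontier_unit_cube in_face_interior_def by blast
  then have "norm w \<le> sqrt 3 / 2" by (rule norm_frontier_unit_cube_le)
  also have "\<dots> \<le> 1" using real_sqrt_le_mono[of 3 4] by simp
  finally show ?thesis
    using norm_face_normal_le[of w] by (intro mult_le_one) auto
next
  case False
  then have "face_normal w = 0" by (simp add: face_normal_def vec_eq_iff)
  then show ?thesis by simp
qed

lemma integrable_face_normal_nth: "integrable cube_area (\<lambda>w. face_normal w $ i)"
proof (rule cube_area.integrable_const_bound[where B = 1])
  show "AE w in cube_area. norm (face_normal w $ i) \<le> 1"
    using order_trans[OF component_le_norm_cart norm_face_normal_le] by (intro AE_I2) simp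
qed (use face_normal_nth_measurable in measurable)

lemma integrable_face_normal_moment: "integrable cube_area (\<lambda>w. face_normal w $ i * w $ j)"
proof (rule cube_area.integrable_const_bound[where B = 1])
  have "norm (face_normal w $ i * w $ j) \<le> 1" for w
  proof -
    have "norm (face_normal w $ i * w $ j) \<le> norm (face_normal w) * norm w"
      by (simp add: abs_mult mult_mono component_le_norm_cart)
    also have "\<dots> \<le> 1" using norm_face_normal_mult_le[of w] by (simp add: mult.commute)
    finally show ?thesis .
  qed
  then show "AE w in cube_area. norm (face_normal w $ i * w $ j) \<le> 1" by simp
qed (use face_normal_moment_measurable in measurable)

lemma integral_inner_face_normal: "(\<integral>w. v \<bullet> face_normal w \<partial>cube_area) = 0"
  unfolding inner_vec_def inner_real_def
  by (simp add: Bochner_Integration.integral_sum integrable_face_normal_nth integral_face_normal)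

text \<open>The symmetries of the cube make the matrix of moments \<open>\<integral> \<nu>\<^sub>i w\<^sub>j\<close> a positive multiple of the identity.
  The multiple is the area of a face: the integrand \<open>\<nu>\<^sub>i w\<^sub>i\<close> is \<open>1/2\<close> on two opposite faces.\<close>

lemma integral_face_normal_moments:
  obtains c where "0 < c" "\<And>a b. (\<integral>w. (a \<bullet> w) * (b \<bullet> face_normal w) \<partial>cube_area) = c * (a \<bullet> b)"
proof
  define c where "c = (\<integral>w. face_normal w $ 1 * w $ 1 \<partial>cube_area)"
  show "0 < c" unfolding c_def by (rule integral_face_normal_diag_pos)
  fix a b :: "real^3"
  have eq: "(a \<bullet> w) * (b \<bullet> face_normal w) = (\<Sum>j\<in>UNIV. \<Sum>i\<in>UNIV. (a $ j * b $ i) * (face_normal w $ i * w $ j))" for w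
    by (simp add: inner_vec_def sum_product algebra_simps)
  have "(\<integral>w. (a \<bullet> w) * (b \<bullet> face_normal w) \<partial>cube_area)
      = (\<Sum>j\<in>UNIV. \<Sum>i\<in>UNIV. (a $ j * b $ i) * (\<integral>w. face_normal w $ i * w $ j \<partial>cube_area))"
    unfolding eq
    by (simp add: Bochner_Integration.integral_sum integrable_face_normal_moment)
  also have "\<dots> = (\<Sum>j\<in>UNIV. \<Sum>i\<in>UNIV. if i = j then (a $ j * b $ j) * c else 0)"
  proof (intro sum.cong refl)
    fix i j :: 3
    show "(a $ j * b $ i) * (\<integral>w. face_normal w $ i * w $ j \<partial>cube_area) = (if i = j then (a $ j * b $ j) * c else 0)"
      using integral_face_normal_diag[of i 1] integral_face_normal_offdiag[of i j]
      by (cases "i = j") (simp_all add: c_def)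
  qed
  also have "\<dots> = c * (a \<bullet> b)"
    by (simp add: inner_vec_def sum_distrib_left mult.commute)
  finally show "(\<integral>w. (a \<bullet> w) * (b \<bullet> face_normal w) \<partial>cube_area) = c * (a \<bullet> b)" .
qed

text \<open>A nonzero integer flux is at least one. The part of the field where \<open>|Y| \<le> \<lambda>\<close>, with \<open>\<lambda> = 1/\<mu>\<^sup>2\<close>,
  contributes to the flux at most \<open>\<lambda>\<close> times the area \<open>s r\<^sup>2\<close>, which is \<open>1/2\<close> by the choice of \<open>\<mu>\<close>. Hence at
  least half of a nonzero flux comes from the points with \<open>|Y| > \<lambda>\<close>, where \<open>|Y| \<le> \<mu> |Y|\<^bsup>3/2\<^esup>\<close>.\<close>

lemma integer_mean_flux_bound:
  fixes Y :: "real^3 \<Rightarrow> real^3"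
  assumes Y [measurable]: "Y \<in> borel_measurable borel" and r: "0 < r"
    and \<mu>: "0 < \<mu>" "\<mu>\<^sup>2 = 2 * measure cube_area UNIV * r\<^sup>2" and int: "r\<^sup>2 * mean_flux Y x r \<in> \<int>"
  defines "h \<equiv> \<lambda>z. ennreal (norm (Y z) * sqrt (norm (Y z))) * indicator {1 / \<mu>\<^sup>2<..} (norm (Y z))"
  shows "ennreal \<bar>mean_flux Y x r\<bar> \<le> ennreal (2 * \<mu>) * (\<integral>\<^sup>+w. h (r *\<^sub>R w + x) \<partial>cube_area)"
proof (cases "(\<integral>\<^sup>+w. h (r *\<^sub>R w + x) \<partial>cube_area) = top")
  case True
  then show ?thesis using \<mu>(1) by (simp add: ennreal_mult_top)
next
  case False
  then obtain \<eta> where \<eta>: "(\<integral>\<^sup>+w. h (r *\<^sub>R w + x) \<partial>cube_area) = ennreal \<eta>" "0 \<le> \<eta>"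
    by (cases "\<integral>\<^sup>+w. h (r *\<^sub>R w + x) \<partial>cube_area") auto
  define s where "s = measure cube_area UNIV"
  have s: "emeasure cube_area UNIV = ennreal s" "0 \<le> s"
    by (simp_all add: s_def cube_area.emeasure_eq_measure)
  have [measurable]: "h \<in> borel_measurable borel" unfolding h_def by measurable
  \<comment> \<open>The pointwise splitting at height \<open>1/\<mu>\<^sup>2\<close>: above it, \<open>\<mu> sqrt |Y z| \<ge> 1\<close>.\<close>
  have pt: "ennreal (norm (Y z)) \<le> ennreal (1 / \<mu>\<^sup>2) + ennreal \<mu> * h z" for z
  proof (cases "norm (Y z) \<le> 1 / \<mu>\<^sup>2")
    case True
    then have "ennreal (norm (Y z)) \<le> ennreal (1 / \<mu>\<^sup>2)" by (rule ennreal_leI)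
    then show ?thesis by (rule order_trans) simp
  next
    case False
    let ?t = "norm (Y z)"
    have "1 / \<mu>\<^sup>2 < ?t" using False by simp
    then have "1 < \<mu>\<^sup>2 * ?t" using \<mu>(1) by (simp add: pos_divide_less_eq mult.commute)
    then have "sqrt 1 \<le> sqrt (\<mu>\<^sup>2 * ?t)" by (intro real_sqrt_le_mono) simp
    then have "1 \<le> \<mu> * sqrt ?t" using \<mu>(1) by (simp add: real_sqrt_mult)
    then have "?t * 1 \<le> ?t * (\<mu> * sqrt ?t)" by (intro mult_left_mono) auto
    then have "ennreal ?t \<le> ennreal (\<mu> * (?t * sqrt ?t))" by (intro ennreal_leI) (simp add: algebra_simps)
    also have "\<dots> = ennreal \<mu> * h z"
      using False \<mu>(1) by (simp add: h_def ennreal_mult)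
    finally show ?thesis by (rule order_trans) simp
  qed
  have "ennreal \<bar>mean_flux Y x r\<bar> \<le> (\<integral>\<^sup>+w. ennreal (norm (Y (r *\<^sub>R w + x))) \<partial>cube_area)"
    by (rule abs_mean_flux_le)
  also have "\<dots> \<le> (\<integral>\<^sup>+w. ennreal (1 / \<mu>\<^sup>2) + ennreal \<mu> * h (r *\<^sub>R w + x) \<partial>cube_area)"
    by (intro nn_integral_mono pt)
  also have "\<dots> = ennreal (1 / \<mu>\<^sup>2) * ennreal s + ennreal \<mu> * ennreal \<eta>"
    by (subst nn_integral_add) (simp_all add: nn_integral_cmult \<eta> s)
  also have "\<dots> = ennreal (s / \<mu>\<^sup>2 + \<mu> * \<eta>)"
    using s \<mu> \<eta> by (simp add: ennreal_mult[symmetric] ennreal_plus[symmetric] del: ennreal_plus)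
  finally have "\<bar>mean_flux Y x r\<bar> \<le> s / \<mu>\<^sup>2 + \<mu> * \<eta>"
    using s \<mu> \<eta> by (subst (asm) ennreal_le_iff) auto
  then have "r\<^sup>2 * \<bar>mean_flux Y x r\<bar> \<le> r\<^sup>2 * (s / \<mu>\<^sup>2 + \<mu> * \<eta>)"
    by (rule mult_left_mono) simp
  also have "\<dots> = 1/2 + r\<^sup>2 * (\<mu> * \<eta>)"
  proof -
    have "s \<noteq> 0" using \<mu> by (auto simp: s_def)
    then have "r\<^sup>2 * (s / \<mu>\<^sup>2) = 1/2"
      unfolding \<mu>(2) s_def[symmetric] using r by (simp add: field_simps)
    then show ?thesis by (simp only: distrib_left)
  qed
  finally have bound: "r\<^sup>2 * \<bar>mean_flux Y x r\<bar> \<le> 1/2 + r\<^sup>2 * (\<mu> * \<eta>)" .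
  have "\<bar>mean_flux Y x r\<bar> \<le> 2 * \<mu> * \<eta>"
  proof (cases "mean_flux Y x r = 0")
    case True
    then show ?thesis using \<mu> \<eta> by simp
  next
    case False
    then have "1 \<le> \<bar>r\<^sup>2 * mean_flux Y x r\<bar>"
      using int r by (intro Ints_nonzero_abs_ge1) auto
    then have "1 \<le> r\<^sup>2 * \<bar>mean_flux Y x r\<bar>" by (simp add: abs_mult)
    with bound have "r\<^sup>2 * \<bar>mean_flux Y x r\<bar> \<le> r\<^sup>2 * (2 * \<mu> * \<eta>)" by simp
    then show ?thesis using r by (simp add: mult_le_cancel_left_pos)
  qed
  then have "ennreal \<bar>mean_flux Y x r\<bar> \<le> ennreal (2 * \<mu> * \<eta>)" by (rule ennreal_leI)
  then show ?thesis using \<mu> \<eta> by (simp add: ennreal_mult)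
qed

lemma nn_integral_tail_tendsto_0:
  assumes f [measurable]: "f \<in> borel_measurable M" and g [measurable]: "(g :: 'a \<Rightarrow> real) \<in> borel_measurable M"
    and fin: "(\<integral>\<^sup>+z. f z \<partial>M) < \<infinity>" and c: "filterlim c at_top sequentially"
  shows "(\<lambda>n. \<integral>\<^sup>+z. f z * indicator {c n<..} (g z) \<partial>M) \<longlonglongrightarrow> 0"
proof -
  have "(\<lambda>n. \<integral>\<^sup>+z. f z * indicator {c n<..} (g z) \<partial>M) \<longlonglongrightarrow> (\<integral>\<^sup>+z. 0 \<partial>M)"
  proof (rule nn_integral_dominated_convergence[where w = f])
    show "AE z in M. (\<lambda>n. f z * indicator {c n<..} (g z)) \<longlonglongrightarrow> 0"
    proof (rule AE_I2)
      fix z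
      have "eventually (\<lambda>n. g z \<le> c n) sequentially"
        using c by (simp add: filterlim_at_top)
      then have "eventually (\<lambda>n. 0 = f z * indicator {c n<..} (g z)) sequentially"
        by eventually_elim simp
      then show "(\<lambda>n. f z * indicator {c n<..} (g z)) \<longlonglongrightarrow> 0"
        by (rule Lim_transform_eventually[OF tendsto_const])
    qed
    show "AE z in M. f z * indicator {c j<..} (g z) \<le> f z" for j
      by (auto simp: indicator_def)
  qed (use fin in auto)
  then show ?thesis by simp
qed

lemma AE_lborel_obtain:
  fixes a b :: real
  assumes "AE r in lborel. P r" "a < b"
  obtains r where "a < r" "r < b" "P r"
proof -
  have "\<exists>r. a < r \<and> r < b \<and> P r"
  proof (rule ccontr)
    assume no: "\<not> ?thesis"
    have "AE r in lborel. r \<notin> {a<..<b}"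
      using assms(1) by eventually_elim (use no in auto)
    then have "emeasure lborel {a<..<b} = 0"
      by (subst (asm) AE_iff_measurable[where N = "{a<..<b}"]) auto
    then show False using assms(2) by simp
  qed
  then show thesis using that by blast
qed

section \<open>Test functions\<close>

lemma has_derivative_gradient:
  fixes \<phi> :: "'a::euclidean_space \<Rightarrow> real"
  assumes "\<phi> differentiable (at x)"
  shows "(\<phi> has_derivative (\<lambda>h. gradient \<phi> x \<bullet> h)) (at x)"
proof -
  have D: "(\<phi> has_derivative frechet_derivative \<phi> (at x)) (at x)"
    using assms by (simp add: frechet_derivative_works)
  then have lin: "linear (frechet_derivative \<phi> (at x))" by (rule has_derivative_linear)
  have "frechet_derivative \<phi> (at x) h = gradient \<phi> x \<bullet> h" for h
  proof -
    have "frechet_derivative \<phi> (at x) h = frechet_derivative \<phi> (at x) (\<Sum>b\<in>Basis. (h \<bullet> b) *\<^sub>R b)"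
      by (simp add: euclidean_representation)
    also have "\<dots> = (\<Sum>b\<in>Basis. (h \<bullet> b) * frechet_derivative \<phi> (at x) b)"
      using lin by (simp add: linear_sum linear_cmul)
    also have "\<dots> = gradient \<phi> x \<bullet> h"
      unfolding gradient_def inner_sum_left inner_scaleR_left
      by (intro sum.cong refl) (metis inner_commute mult.commute)
    finally show ?thesis .
  qed
  then have "frechet_derivative \<phi> (at x) = (\<lambda>h. gradient \<phi> x \<bullet> h)" by (rule ext)
  with D show ?thesis by simp
qed

lemma test_function_differentiable:
  "\<phi> \<in> test_functions \<Omega> \<Longrightarrow> \<phi> differentiable (at x)"
proof -
  assume "\<phi> \<in> test_functions \<Omega>"
  then have "C_k (Suc 0) \<phi>" unfolding test_functions_def by blast
  then show ?thesis by simp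
qed

lemma test_function_continuous: "\<phi> \<in> test_functions \<Omega> \<Longrightarrow> continuous_on UNIV \<phi>"
proof -
  assume "\<phi> \<in> test_functions \<Omega>"
  then have "C_k 0 \<phi>" unfolding test_functions_def by blast
  then show ?thesis by simp
qed

lemma test_function_gradient_continuous:
  "\<phi> \<in> test_functions \<Omega> \<Longrightarrow> continuous_on UNIV (gradient \<phi>)"
proof -
  assume "\<phi> \<in> test_functions \<Omega>"
  then have "C_k (Suc 0) \<phi>" unfolding test_functions_def by blast
  then show ?thesis unfolding gradient_def[abs_def] by (intro continuous_intros) simp
qed

lemma compact_support_bounded:
  fixes f :: "'a::topological_space \<Rightarrow> 'b::real_normed_vector"
  assumes "continuous_on UNIV f" "compact K" "\<And>x. x \<notin> K \<Longrightarrow> f x = 0"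
  obtains B where "0 \<le> B" "\<And>x. norm (f x) \<le> B"
proof -
  have "compact (f ` K)"
    using assms by (intro compact_continuous_image) (auto intro: continuous_on_subset)
  then obtain B where B: "\<And>y. y \<in> f ` K \<Longrightarrow> norm y \<le> B"
    using compact_imp_bounded bounded_iff by metis
  have "norm (f x) \<le> max 0 B" for x
    using B[of "f x"] assms(3)[of x] by (cases "x \<in> K") (auto simp: le_max_iff_disj)
  then show thesis by (intro that[of "max 0 B"]) auto
qed

lemma test_function_bounded:
  assumes "\<phi> \<in> test_functions \<Omega>"
  obtains B where "0 \<le> B" "\<And>x. \<bar>\<phi> x\<bar> \<le> B"
proof -
  have "compact (closure {x. \<phi> x \<noteq> 0})" using assms by (simp add: test_functions_def)
  moreover have "\<phi> x = 0" if "x \<notin> closure {x. \<phi> x \<noteq> 0}" for x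
    using that closure_subset[of "{x. \<phi> x \<noteq> 0}"] by blast
  ultimately obtain B where "0 \<le> B" "\<And>x. norm (\<phi> x) \<le> B"
    using compact_support_bounded[OF test_function_continuous[OF assms]] by metis
  then show thesis using that by simp
qed

text \<open>The gradient is continuous and vanishes off the compact support, so it is bounded.\<close>

lemma test_function_Lipschitz:
  fixes \<phi> :: "'a::euclidean_space \<Rightarrow> real"
  assumes "\<phi> \<in> test_functions \<Omega>"
  obtains L where "0 \<le> L" "\<And>x y. \<bar>\<phi> x - \<phi> y\<bar> \<le> L * norm (x - y)"
proof -
  let ?K = "closure {x. \<phi> x \<noteq> 0}"
  have K: "compact ?K" using assms by (simp add: test_functions_def)
  have z: "gradient \<phi> x = 0" if "x \<notin> ?K" for x
  proof -
    have z: "\<phi> y = 0" if "y \<in> - ?K" for y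
      using that closure_subset[of "{x. \<phi> x \<noteq> 0}"] by blast
    have "(\<phi> has_derivative (\<lambda>h. 0)) (at x)"
    proof (rule has_derivative_transform_within_open[OF has_derivative_const])
      show "open (- ?K)" by (simp add: open_Compl)
      show "x \<in> - ?K" using that by simp
    qed (rule z[symmetric])
    then have "frechet_derivative \<phi> (at x) = (\<lambda>h. 0)"
      by (rule frechet_derivative_at[symmetric])
    then show ?thesis by (simp add: gradient_def)
  qed
  obtain L where L: "0 \<le> L" "\<And>x. norm (gradient \<phi> x) \<le> L"
    using compact_support_bounded[OF test_function_gradient_continuous[OF assms] K z] by metis
  have "norm (\<phi> x - \<phi> y) \<le> L * norm (x - y)" for x y
  proof (rule differentiable_bound[where S = UNIV and f' = "\<lambda>x h. gradient \<phi> x \<bullet> h"])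
    show "(\<phi> has_derivative (\<lambda>h. gradient \<phi> x \<bullet> h)) (at x)" for x
      by (intro has_derivative_gradient test_function_differentiable[OF assms])
    show "onorm (\<lambda>h. gradient \<phi> x \<bullet> h) \<le> L" for x
    proof (rule onorm_le)
      fix h
      have "norm (gradient \<phi> x \<bullet> h) \<le> norm (gradient \<phi> x) * norm h"
        using Cauchy_Schwarz_ineq2 by simp
      also have "\<dots> \<le> L * norm h" using L by (intro mult_right_mono) auto
      finally show "norm (gradient \<phi> x \<bullet> h) \<le> L * norm h" .
    qed
  qed auto
  then show thesis using L(1) that by simp
qed

lemma test_function_support_in_ball:
  fixes \<phi> :: "'a::euclidean_space \<Rightarrow> real"
  assumes "\<phi> \<in> test_functions (ball 0 1)"
  obtains \<rho> where "\<rho> < 1" "\<And>x. \<phi> x \<noteq> 0 \<Longrightarrow> norm x \<le> \<rho>"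
proof (cases "closure {x. \<phi> x \<noteq> 0} = {}")
  case True
  then have "\<phi> x = 0" for x using closure_subset[of "{x. \<phi> x \<noteq> 0}"] by blast
  then show thesis by (intro that[of 0]) auto
next
  case False
  have K: "compact (closure {x. \<phi> x \<noteq> 0})" and sub: "closure {x. \<phi> x \<noteq> 0} \<subseteq> ball 0 1"
    using assms by (auto simp: test_functions_def)
  obtain m where m: "m \<in> closure {x. \<phi> x \<noteq> 0}" "\<And>x. x \<in> closure {x. \<phi> x \<noteq> 0} \<Longrightarrow> norm x \<le> norm m"
    using continuous_attains_sup[OF K False continuous_on_norm_id] by blast
  show thesis
  proof (rule that)
    show "norm m < 1" using m sub by auto
    show "norm x \<le> norm m" if "\<phi> x \<noteq> 0" for x
      using that m(2) closure_subset[of "{x. \<phi> x \<noteq> 0}"] by blast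
  qed
qed

section \<open>The divergence as a limit of fluxes\<close>

lemma integrable_fst_cube_area:
  fixes f :: "real^3 \<Rightarrow> real"
  assumes "integrable lborel f"
  shows "integrable (lborel \<Otimes>\<^sub>M cube_area) (\<lambda>p. f (fst p))"
proof (rule integrableI_bounded)
  have f [measurable]: "f \<in> borel_measurable borel" using assms by auto
  show "(\<lambda>p. f (fst p)) \<in> borel_measurable (lborel \<Otimes>\<^sub>M cube_area)" by measurable
  have "(\<integral>\<^sup>+p. ennreal (norm (f (fst p))) \<partial>(lborel \<Otimes>\<^sub>M cube_area)) = (\<integral>\<^sup>+z. ennreal (norm (f z)) * emeasure cube_area UNIV \<partial>lborel)"
    by (subst cube_area.nn_integral_fst[symmetric]) simp_all
  also have "\<dots> = (\<integral>\<^sup>+z. ennreal (norm (f z)) \<partial>lborel) * emeasure cube_area UNIV"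
    by (rule nn_integral_multc) simp
  also have "\<dots> < \<infinity>"
    using assms by (simp add: integrable_iff_bounded ennreal_mult_less_top cube_area.emeasure_eq_measure)
  finally show "(\<integral>\<^sup>+p. ennreal (norm (f (fst p))) \<partial>(lborel \<Otimes>\<^sub>M cube_area)) < \<infinity>" .
qed

lemma inner_face_normal_le: "\<bar>y \<bullet> face_normal w\<bar> \<le> norm y * norm (face_normal w)"
  by (rule Cauchy_Schwarz_ineq2)

lemma inner_face_normal_le_norm: "\<bar>y \<bullet> face_normal w\<bar> \<le> norm y"
proof -
  have "norm y * norm (face_normal w) \<le> norm y * 1"
    by (intro mult_left_mono norm_face_normal_le) simp
  then show ?thesis using inner_face_normal_le[of y w] by simp
qed

text \<open>The shear \<open>z = r w + x\<close> moves the translation from the field to the test function.\<close>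

lemma integral_test_flux_eq:
  fixes Y :: "real^3 \<Rightarrow> real^3" and \<phi> :: "real^3 \<Rightarrow> real"
  assumes Y [measurable]: "Y \<in> borel_measurable borel" and Yi: "integrable lborel Y"
    and \<phi>: "continuous_on UNIV \<phi>" and \<phi>B: "\<And>x. \<bar>\<phi> x\<bar> \<le> B"
  shows "(\<integral>p. \<phi> (fst p - r *\<^sub>R snd p) * (Y (fst p) \<bullet> face_normal (snd p)) \<partial>(lborel \<Otimes>\<^sub>M cube_area))
      = (\<integral>x. \<phi> x * mean_flux Y x r \<partial>lborel)" (is "integral\<^sup>L ?P ?g = _")
    and "integrable (lborel \<Otimes>\<^sub>M cube_area) (\<lambda>p. \<phi> (fst p - r *\<^sub>R snd p) * (Y (fst p) \<bullet> face_normal (snd p)))"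
proof -
  let ?T = "\<lambda>(x, w). (r *\<^sub>R w + x, w)"
  have [measurable]: "\<phi> \<in> borel_measurable borel" using \<phi> by (rule borel_measurable_continuous_onI)
  have gm [measurable]: "?g \<in> borel_measurable ?P" by measurable
  have gi: "integrable ?P ?g"
  proof (rule Bochner_Integration.integrable_bound)
    show "integrable ?P (\<lambda>p. B * norm (Y (fst p)))"
      using Yi by (intro integrable_mult_right integrable_fst_cube_area) auto
    show "AE p in ?P. norm (?g p) \<le> norm (B * norm (Y (fst p)))"
    proof (rule AE_I2)
      fix p :: "(real^3) \<times> (real^3)"
      have "norm (?g p) \<le> B * norm (Y (fst p))"
        unfolding real_norm_def abs_mult
        using \<phi>B[of "fst p - r *\<^sub>R snd p"] by (intro mult_mono inner_face_normal_le_norm) auto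
      then show "norm (?g p) \<le> norm (B * norm (Y (fst p)))" by simp
    qed
  qed (rule gm)
  show "integrable ?P ?g" by fact
  have "integral\<^sup>L ?P ?g = integral\<^sup>L (distr ?P ?P ?T) ?g"
    by (simp add: distr_shear)
  also have "\<dots> = (\<integral>p. ?g (?T p) \<partial>?P)"
    by (rule integral_distr) simp_all
  also have "\<dots> = (\<integral>x. \<integral>w. ?g (?T (x, w)) \<partial>cube_area \<partial>lborel)"
  proof (rule space_cube.integral_fst'[symmetric])
    show "integrable ?P (\<lambda>p. ?g (?T p))"
      using gi by (subst integrable_distr_eq[of ?T ?P ?P, symmetric]) (simp_all add: distr_shear)
  qed
  also have "\<dots> = (\<integral>x. \<phi> x * mean_flux Y x r \<partial>lborel)"
    by (simp add: mean_flux_def)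
  finally show "integral\<^sup>L ?P ?g = (\<integral>x. \<phi> x * mean_flux Y x r \<partial>lborel)" .
qed

lemma difference_quotient_tendsto:
  fixes \<phi> :: "'a::euclidean_space \<Rightarrow> real"
  assumes d: "\<phi> differentiable (at z)" and r: "r \<longlonglongrightarrow> 0" "\<And>n. r n \<noteq> 0"
  shows "(\<lambda>n. (\<phi> (z - r n *\<^sub>R w) - \<phi> z) / r n) \<longlonglongrightarrow> - (gradient \<phi> z \<bullet> w)"
proof -
  have "(\<phi> has_derivative (\<lambda>h. gradient \<phi> z \<bullet> h)) (at (z - 0 *\<^sub>R w))"
    using has_derivative_gradient[OF d] by simp
  then have "((\<lambda>t. \<phi> (z - t *\<^sub>R w)) has_derivative (\<lambda>t. gradient \<phi> z \<bullet> (- (t *\<^sub>R w)))) (at 0)"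
    by (rule has_derivative_compose[rotated]) (auto intro!: derivative_eq_intros)
  then have "((\<lambda>t. \<phi> (z - t *\<^sub>R w)) has_real_derivative - (gradient \<phi> z \<bullet> w)) (at 0)"
    by (rule has_derivative_imp_has_field_derivative) simp
  then have "((\<lambda>h. (\<phi> (z - h *\<^sub>R w) - \<phi> z) / h) \<longlongrightarrow> - (gradient \<phi> z \<bullet> w)) (at 0)"
    by (simp add: DERIV_def)
  moreover have "filterlim r (at 0) sequentially"
    using r by (simp add: filterlim_at)
  ultimately show ?thesis
    by (rule filterlim_compose)
qed

lemma cube_area_pos: "0 < measure cube_area UNIV"
proof (rule ccontr)
  assume "\<not> 0 < measure cube_area UNIV"
  then have "emeasure cube_area (space cube_area) = 0"
    using measure_nonneg[of cube_area UNIV] by (simp add: cube_area.emeasure_eq_measure)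
  then have "(\<integral>w. face_normal w $ i * w $ i \<partial>cube_area) = 0" for i
    by (subst integral_cong_AE[where g = "\<lambda>_. 0"]) (auto simp: emeasure_0_AE)
  then show False using integral_face_normal_diag_pos[of 1] by simp
qed

text \<open>Let \<open>A\<close> be the integral of \<open>\<phi>\<close> against the flux through cubes of size \<open>r\<close>, divided by \<open>r\<^sup>3\<close>. After the
  shear, \<open>A\<close> contains the difference quotient of \<open>\<phi>\<close> at \<open>z\<close> in the direction \<open>-w\<close>, because the normal field has
  mean zero; by dominated convergence \<open>A\<close> tends to \<open>-c \<integral> Y \<bullet> \<nabla>\<phi>\<close>. On the other hand the bound on integer
  fluxes, integrated over all centres, estimates \<open>A\<close> by a multiple of \<open>\<integral> |Y|\<^bsup>3/2\<^esup>\<close> over the set where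
  \<open>|Y| > 1/(2 s r\<^sup>2)\<close>. The powers of \<open>r\<close> cancel exactly for the exponent \<open>3/2\<close>, and the integral tends to
  zero with \<open>r\<close>.\<close>

lemma divergence_free_if_integer_flux:
  fixes Y :: "real^3 \<Rightarrow> real^3" and \<phi> :: "real^3 \<Rightarrow> real"
  assumes Y [measurable]: "Y \<in> borel_measurable borel" and Yi: "integrable lborel Y"
    and Y32: "integrable lborel (\<lambda>z. norm (Y z) * sqrt (norm (Y z)))"
    and int: "AE r in lborel. AE x in lborel.
      norm x + sqrt 3 * r < 1 \<longrightarrow> 0 < r \<longrightarrow> r\<^sup>2 * mean_flux Y x r \<in> \<int>"
    and \<phi>: "\<phi> \<in> test_functions (ball 0 1)"
  shows "(\<integral>z. Y z \<bullet> gradient \<phi> z \<partial>lborel) = 0"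
proof -
  let ?P = "lborel \<Otimes>\<^sub>M cube_area"
  note cont = test_function_continuous[OF \<phi>]
  have [measurable]: "\<phi> \<in> borel_measurable borel" using cont by (rule borel_measurable_continuous_onI)
  have [measurable]: "gradient \<phi> \<in> borel_measurable borel"
    using test_function_gradient_continuous[OF \<phi>] by (rule borel_measurable_continuous_onI)
  obtain B where B: "0 \<le> B" "\<And>x. \<bar>\<phi> x\<bar> \<le> B" 
    by (rule test_function_bounded[OF \<phi>]) blast
  obtain L where L: "0 \<le> L" "\<And>x y. \<bar>\<phi> x - \<phi> y\<bar> \<le> L * norm (x - y)" 
    by (rule test_function_Lipschitz[OF \<phi>]) blast
  obtain \<rho> where \<rho>: "\<rho> < 1" "\<And>x. \<phi> x \<noteq> 0 \<Longrightarrow> norm x \<le> \<rho>" 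
    by (rule test_function_support_in_ball[OF \<phi>]) blast
  obtain c where c: "0 < c" "\<And>a b. (\<integral>w. (a \<bullet> w) * (b \<bullet> face_normal w) \<partial>cube_area) = c * (a \<bullet> b)"
    by (rule integral_face_normal_moments) blast
  \<comment> \<open>For sizes below \<open>d\<close>, all cubes centred in the support of \<open>\<phi>\<close> lie in the unit ball.\<close>
  define d where "d = (1 - \<rho>) / sqrt 3"
  have d: "0 < d" using \<rho> by (simp add: d_def)
  have "\<forall>n. \<exists>r. 0 < r \<and> r < d / real (Suc n) \<and>
      (AE x in lborel. norm x + sqrt 3 * r < 1 \<longrightarrow> 0 < r \<longrightarrow> r\<^sup>2 * mean_flux Y x r \<in> \<int>)"
  proof
    fix n
    have "0 < d / real (Suc n)" using d by simp
    then show "\<exists>r. 0 < r \<and> r < d / real (Suc n) \<and>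
        (AE x in lborel. norm x + sqrt 3 * r < 1 \<longrightarrow> 0 < r \<longrightarrow> r\<^sup>2 * mean_flux Y x r \<in> \<int>)"
      by (rule AE_lborel_obtain[OF int]) blast
  qed
  from choice[OF this] obtain r where r: "\<And>n. 0 < r n" "\<And>n. r n < d / real (Suc n)"
    and rint: "\<And>n. AE x in lborel. norm x + sqrt 3 * r n < 1 \<longrightarrow> 0 < r n \<longrightarrow> (r n)\<^sup>2 * mean_flux Y x (r n) \<in> \<int>"
    by blast
  have r0: "r \<longlonglongrightarrow> 0"
  proof (rule tendsto_sandwich[of "\<lambda>_. 0" r sequentially "\<lambda>n. d / real (Suc n)"])
    show "(\<lambda>n. d / real (Suc n)) \<longlonglongrightarrow> 0"
      using LIMSEQ_Suc[OF lim_const_over_n[of d]] by simp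
    show "eventually (\<lambda>n. 0 \<le> r n) sequentially" "eventually (\<lambda>n. r n \<le> d / real (Suc n)) sequentially"
      using r by (auto intro!: always_eventually less_imp_le)
  qed simp
  have rne: "r n \<noteq> 0" for n using r(1)[of n] by simp
  have rd: "sqrt 3 * r n < 1 - \<rho>" for n
  proof -
    have "d / real (Suc n) \<le> d / 1" using d by (intro divide_left_mono) auto
    then have "r n < d" using r(2)[of n] by simp
    then show ?thesis by (simp add: d_def pos_less_divide_eq mult.commute)
  qed
  define G where "G n p = (\<phi> (fst p - r n *\<^sub>R snd p) - \<phi> (fst p)) / r n * (Y (fst p) \<bullet> face_normal (snd p))" for n p
  define A where "A n = (\<integral>x. \<phi> x * mean_flux Y x (r n) \<partial>lborel) / r n" for n
  have GA: "integral\<^sup>L ?P (G n) = A n" for n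
  proof -
    note 1 = integral_test_flux_eq[OF Y Yi cont B(2), of "r n"]
    note 2 = integral_test_flux_eq[OF Y Yi cont B(2), of 0]
    \<comment> \<open>The formula for \<open>r = 0\<close> expresses that the normal field has mean zero.\<close>
    have "mean_flux Y x 0 = 0" for x
      by (simp add: mean_flux_def integral_inner_face_normal)
    then have 3: "(\<integral>p. \<phi> (fst p) * (Y (fst p) \<bullet> face_normal (snd p)) \<partial>?P) = 0"
      using 2(1) by simp
    have "integral\<^sup>L ?P (G n) = (\<integral>p. (\<phi> (fst p - r n *\<^sub>R snd p) * (Y (fst p) \<bullet> face_normal (snd p))
        - \<phi> (fst p) * (Y (fst p) \<bullet> face_normal (snd p))) / r n \<partial>?P)"
      by (rule Bochner_Integration.integral_cong) (simp_all add: G_def left_diff_distrib diff_divide_distrib)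
    also have "\<dots> = ((\<integral>p. \<phi> (fst p - r n *\<^sub>R snd p) * (Y (fst p) \<bullet> face_normal (snd p)) \<partial>?P)
        - (\<integral>p. \<phi> (fst p) * (Y (fst p) \<bullet> face_normal (snd p)) \<partial>?P)) / r n"
      using 1(2) 2(2) by (simp add: Bochner_Integration.integral_diff)
    finally show ?thesis by (simp add: 1(1) 3 A_def)
  qed
  define F where "F p = - (gradient \<phi> (fst p) \<bullet> snd p) * (Y (fst p) \<bullet> face_normal (snd p))" for p
  have Gm: "G n \<in> borel_measurable ?P" for n unfolding G_def by measurable
  have Fm: "F \<in> borel_measurable ?P" unfolding F_def by measurable
  have dom: "integrable ?P (\<lambda>p. L * norm (Y (fst p)))"
    using Yi by (intro integrable_mult_right integrable_fst_cube_area) auto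
  have lim: "(\<lambda>n. G n p) \<longlonglongrightarrow> F p" for p
    unfolding G_def F_def
    by (intro tendsto_mult_right difference_quotient_tendsto[OF test_function_differentiable[OF \<phi>] r0 rne])
  \<comment> \<open>The bound is uniform in \<open>w\<close>, since \<open>|w| |\<nu> w| \<le> 1\<close> on the whole space.\<close>
  have Gbound: "norm (G n p) \<le> L * norm (Y (fst p))" for n p
  proof -
    let ?w = "snd p" and ?\<nu> = "face_normal (snd p)"
    have "\<bar>\<phi> (fst p - r n *\<^sub>R ?w) - \<phi> (fst p)\<bar> / r n \<le> L * norm ?w"
      using L(2)[of "fst p - r n *\<^sub>R ?w" "fst p"] r(1)[of n] by (simp add: pos_divide_le_eq mult.assoc mult.commute[of "r n"])
    then have "norm (G n p) \<le> (L * norm ?w) * (norm (Y (fst p)) * norm ?\<nu>)"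
      unfolding G_def real_norm_def abs_mult abs_divide using r(1)[of n] L(1)
      by (intro mult_mono inner_face_normal_le) auto
    also have "\<dots> = L * norm (Y (fst p)) * (norm ?w * norm ?\<nu>)" by (simp add: algebra_simps)
    also have "\<dots> \<le> L * norm (Y (fst p)) * 1"
      using L(1) by (intro mult_left_mono norm_face_normal_mult_le) auto
    finally show ?thesis by simp
  qed
  have "(\<lambda>n. integral\<^sup>L ?P (G n)) \<longlonglongrightarrow> integral\<^sup>L ?P F"
    by (rule integral_dominated_convergence[OF Fm Gm dom]; rule AE_I2, rule lim Gbound)
  then have limA: "A \<longlonglongrightarrow> integral\<^sup>L ?P F" by (simp add: GA)
  have "integrable ?P F"
  proof (rule Bochner_Integration.integrable_bound[OF dom Fm], rule AE_I2)
    fix p :: "(real^3) \<times> (real^3)"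
    have "norm (F p) \<le> L * norm (Y (fst p))"
      by (rule tendsto_upperbound[OF tendsto_norm[OF lim]], rule always_eventually, rule allI, rule Gbound, simp)
    then show "norm (F p) \<le> norm (L * norm (Y (fst p)))" by simp
  qed
  then have "integral\<^sup>L ?P F = (\<integral>z. \<integral>w. F (z, w) \<partial>cube_area \<partial>lborel)"
    by (rule space_cube.integral_fst'[symmetric])
  also have "\<dots> = (\<integral>z. - c * (gradient \<phi> z \<bullet> Y z) \<partial>lborel)"
    by (intro Bochner_Integration.integral_cong refl) (simp add: F_def c(2))
  also have "\<dots> = (\<integral>z. - c * (Y z \<bullet> gradient \<phi> z) \<partial>lborel)"
    by (simp only: inner_commute)
  also have "\<dots> = - c * (\<integral>z. Y z \<bullet> gradient \<phi> z \<partial>lborel)" by simp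
  finally have F: "integral\<^sup>L ?P F = - c * (\<integral>z. Y z \<bullet> gradient \<phi> z \<partial>lborel)" .
  define s where "s = measure cube_area UNIV"
  have s: "0 < s" "emeasure cube_area UNIV = ennreal s"
    using cube_area_pos by (simp_all add: s_def cube_area.emeasure_eq_measure)
  define \<mu> where "\<mu> n = sqrt (2 * s) * r n" for n
  have \<mu>: "0 < \<mu> n" "(\<mu> n)\<^sup>2 = 2 * s * (r n)\<^sup>2" for n
    using s r by (simp_all add: \<mu>_def power_mult_distrib)
  define h where "h n z = ennreal (norm (Y z) * sqrt (norm (Y z))) * indicator {1 / (\<mu> n)\<^sup>2<..} (norm (Y z))" for n z
  have hm [measurable]: "h n \<in> borel_measurable borel" for n unfolding h_def by measurable
  have "(\<lambda>n. \<integral>\<^sup>+z. h n z \<partial>lborel) \<longlonglongrightarrow> 0"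
    unfolding h_def
  proof (rule nn_integral_tail_tendsto_0)
    show "(\<integral>\<^sup>+z. ennreal (norm (Y z) * sqrt (norm (Y z))) \<partial>lborel) < \<infinity>"
      using Y32 by (simp add: integrable_iff_bounded)
    have "(\<lambda>n. (\<mu> n)\<^sup>2) \<longlonglongrightarrow> 0"
      unfolding \<mu>_def by (auto intro!: tendsto_eq_intros r0)
    then have "filterlim (\<lambda>n. (\<mu> n)\<^sup>2) (at_right 0) sequentially"
      using \<mu>(1) by (auto simp: filterlim_at intro!: always_eventually) (metis less_irrefl)
    then show "filterlim (\<lambda>n. 1 / (\<mu> n)\<^sup>2) at_top sequentially"
      using filterlim_compose[OF filterlim_inverse_at_top_right] by (simp add: inverse_eq_divide)
  qed measurable
  then have lim0: "(\<lambda>n. ennreal (B * (2 * sqrt (2 * s)) * s) * (\<integral>\<^sup>+z. h n z \<partial>lborel)) \<longlonglongrightarrow> ennreal (B * (2 * sqrt (2 * s)) * s) * 0"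
    by (intro ennreal_tendsto_cmult) simp_all
  have Abound: "ennreal \<bar>A n\<bar> \<le> ennreal (B * (2 * sqrt (2 * s)) * s) * (\<integral>\<^sup>+z. h n z \<partial>lborel)" for n
  proof -
    let ?f = "\<lambda>x. \<phi> x * mean_flux Y x (r n) / r n"
    have "ennreal \<bar>A n\<bar> \<le> (\<integral>\<^sup>+x. ennreal \<bar>?f x\<bar> \<partial>lborel)"
    proof (cases "integrable lborel ?f")
      case True
      then show ?thesis
        using integral_norm_bound_ennreal[OF True] by (simp add: A_def)
    next
      case False
      then show ?thesis by (simp add: A_def not_integrable_integral_eq flip: Bochner_Integration.integral_divide_zero)
    qed
    also have "\<dots> \<le> (\<integral>\<^sup>+x. ennreal (B * (2 * sqrt (2 * s))) * (\<integral>\<^sup>+w. h n (r n *\<^sub>R w + x) \<partial>cube_area) \<partial>lborel)"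
    proof (rule nn_integral_mono_AE)
      show "AE x in lborel. ennreal \<bar>?f x\<bar> \<le> ennreal (B * (2 * sqrt (2 * s))) * (\<integral>\<^sup>+w. h n (r n *\<^sub>R w + x) \<partial>cube_area)"
        using rint[of n]
      proof eventually_elim
        case (elim x)
        show ?case
        proof (cases "\<phi> x = 0")
          case False
          then have "norm x + sqrt 3 * r n < 1" using \<rho>(2)[of x] rd[of n] by linarith
          then have "(r n)\<^sup>2 * mean_flux Y x (r n) \<in> \<int>" using elim r(1) by blast
          from integer_mean_flux_bound[OF Y r(1) \<mu>(1) _ this]
          have m: "ennreal \<bar>mean_flux Y x (r n)\<bar> \<le> ennreal (2 * \<mu> n) * (\<integral>\<^sup>+w. h n (r n *\<^sub>R w + x) \<partial>cube_area)"
            using \<mu>(2) by (simp add: h_def s_def)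
          have "\<bar>?f x\<bar> = (\<bar>\<phi> x\<bar> / r n) * \<bar>mean_flux Y x (r n)\<bar>"
            using r(1)[of n] by (simp add: abs_mult)
          also have "\<dots> \<le> (B / r n) * \<bar>mean_flux Y x (r n)\<bar>"
            using B r(1)[of n] by (intro mult_right_mono divide_right_mono) auto
          finally have "ennreal \<bar>?f x\<bar> \<le> ennreal (B / r n) * ennreal \<bar>mean_flux Y x (r n)\<bar>"
            using B(1) r(1)[of n] by (subst ennreal_mult[symmetric]) (auto intro!: ennreal_leI)
          also have "\<dots> \<le> ennreal (B / r n) * (ennreal (2 * \<mu> n) * (\<integral>\<^sup>+w. h n (r n *\<^sub>R w + x) \<partial>cube_area))"
            by (intro mult_left_mono m) simp
          also have "\<dots> = ennreal (B * (2 * sqrt (2 * s))) * (\<integral>\<^sup>+w. h n (r n *\<^sub>R w + x) \<partial>cube_area)"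
          proof -
            have "B / r n * (2 * \<mu> n) = B * (2 * sqrt (2 * s))"
              using r(1)[of n] by (simp add: \<mu>_def)
            then show ?thesis
              using B(1) r(1)[of n] \<mu>(1)[of n] by (simp add: mult.assoc[symmetric] ennreal_mult[symmetric])
          qed
          finally show ?thesis .
        qed simp
      qed
    qed
    also have "\<dots> = ennreal (B * (2 * sqrt (2 * s))) * (\<integral>\<^sup>+x. \<integral>\<^sup>+w. h n (r n *\<^sub>R w + x) \<partial>cube_area \<partial>lborel)"
      by (rule nn_integral_cmult) measurable
    also have "(\<integral>\<^sup>+x. \<integral>\<^sup>+w. h n (r n *\<^sub>R w + x) \<partial>cube_area \<partial>lborel) = (\<integral>\<^sup>+z. h n z \<partial>lborel) * ennreal s"
      using nn_integral_shear[OF hm] by (simp add: s)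
    also have "ennreal (B * (2 * sqrt (2 * s))) * ((\<integral>\<^sup>+z. h n z \<partial>lborel) * ennreal s)
        = ennreal (B * (2 * sqrt (2 * s)) * s) * (\<integral>\<^sup>+z. h n z \<partial>lborel)"
      using B(1) s(1) by (simp add: ennreal_mult mult.assoc mult.commute mult.left_commute)
    finally show ?thesis .
  qed
  have "(\<lambda>n. ennreal \<bar>A n\<bar>) \<longlonglongrightarrow> 0"
  proof (rule tendsto_sandwich[OF _ _ tendsto_const])
    show "(\<lambda>n. ennreal (B * (2 * sqrt (2 * s)) * s) * (\<integral>\<^sup>+z. h n z \<partial>lborel)) \<longlonglongrightarrow> 0"
      using lim0 by simp
  qed (auto intro!: always_eventually Abound)
  then have "(\<lambda>n. \<bar>A n\<bar>) \<longlonglongrightarrow> 0"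
    using tendsto_ennrealD[of "\<lambda>n. \<bar>A n\<bar>" 0] by simp
  then have "A \<longlonglongrightarrow> 0" by (simp add: tendsto_rabs_zero_iff)
  with limA have "integral\<^sup>L ?P F = 0" by (rule LIMSEQ_unique)
  then show ?thesis using F c(1) by simp
qed

section \<open>Vector fields with integer fluxes are divergence free\<close>

text \<open>Borel measurability makes the field a measurable function of centre, size and surface point
  together.\<close>

lemma Lp_fields_borel_representative:
  assumes X: "X \<in> Lp_fields p (ball 0 1)"
  obtains Y N where "Y \<in> borel_measurable borel" "N \<in> null_sets lborel"
    "\<And>z. z \<in> ball 0 1 \<Longrightarrow> z \<notin> N \<Longrightarrow> X z = Y z" "\<And>z. z \<notin> ball 0 1 \<Longrightarrow> Y z = 0"
    "integrable lborel (\<lambda>z. norm (Y z) powr p)"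
proof -
  let ?X = "\<lambda>z. if z \<in> ball 0 1 then X z else 0"
  have Xm: "X \<in> borel_measurable (lebesgue_on (ball 0 1))"
    and Xi: "integrable (lebesgue_on (ball 0 1)) (\<lambda>z. norm (X z) powr p)"
    using X by (auto simp: Lp_fields_def)
  have "?X \<in> borel_measurable lebesgue"
    using Xm by (subst borel_measurable_if) auto
  then have "(\<lambda>z. ?X z $ i) \<in> borel_measurable lebesgue" for i
    by (rule measurable_compose[OF _ borel_measurable_nth])
  then have "\<exists>g\<in>borel_measurable lborel. AE z in lborel. ?X z $ i = g z" for i
    by (intro completion_ex_borel_measurable_real)
  then have "\<forall>i. \<exists>g. g \<in> borel_measurable lborel \<and> (AE z in lborel. ?X z $ i = g z)"
    by blast
  from choice[OF this] obtain g where g: "\<And>i. g i \<in> borel_measurable lborel" "\<And>i. AE z in lborel. ?X z $ i = g i z"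
    by blast
  define Y where "Y z = (if z \<in> ball 0 1 then (\<chi> i. g i z) else 0)" for z
  have gm [measurable]: "(\<lambda>z. (\<chi> i. g i z)) \<in> borel_measurable borel"
    using g(1) by (subst borel_measurable_euclidean_space) (auto simp: Basis_vec_def inner_axis)
  have [measurable]: "ball 0 1 \<in> sets (borel :: (real^3) measure)" by simp
  have Ym: "Y \<in> borel_measurable borel" unfolding Y_def by measurable
  have "AE z in lborel. \<forall>i\<in>UNIV. ?X z $ i = g i z"
    by (rule AE_finite_allI) (simp, rule g(2))
  then have ae: "AE z in lborel. ?X z = Y z"
    by eventually_elim (auto simp: Y_def vec_eq_iff)
  then obtain N where N: "N \<in> null_sets lborel" "{z. ?X z \<noteq> Y z} \<subseteq> N"
    by (auto simp: eventually_ae_filter)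
  show thesis
  proof
    show "X z = Y z" if "z \<in> ball 0 1" "z \<notin> N" for z
    proof -
      have "?X z = Y z" using N(2) that(2) by blast
      then show ?thesis using that(1) by simp
    qed
    show "Y z = 0" if "z \<notin> ball 0 1" for z using that by (simp add: Y_def)
    have "integrable lebesgue (\<lambda>z. indicator (ball 0 1) z *\<^sub>R (norm (X z) powr p))"
      using Xi by (subst (asm) integrable_restrict_space) auto
    moreover have "AE z in lebesgue. indicator (ball 0 1) z *\<^sub>R (norm (X z) powr p) = norm (Y z) powr p"
      using AE_completion[OF ae] by eventually_elim (auto simp: indicator_def split: if_splits)
    moreover have "(\<lambda>z. norm (Y z) powr p) \<in> borel_measurable lborel" using Ym by measurable
    ultimately have "integrable lebesgue (\<lambda>z. norm (Y z) powr p)"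
      using integrable_cong_AE_imp measurable_completion by blast
    then show "integrable lborel (\<lambda>z. norm (Y z) powr p)"
      using \<open>(\<lambda>z. norm (Y z) powr p) \<in> borel_measurable lborel\<close> by (simp add: integrable_completion)
  qed (fact Ym, fact N(1))
qed

lemma mult_sqrt_eq_powr: "0 \<le> t \<Longrightarrow> t * sqrt t = t powr (3/2)"
proof -
  assume "0 \<le> t"
  then have "t powr (1 + 1/2) = t * sqrt t"
    by (subst powr_add) (simp add: powr_half_sqrt)
  then show ?thesis by simp
qed

lemma integrable_powr_le:
  fixes Y :: "real^3 \<Rightarrow> real^3"
  assumes q: "0 < q" "q \<le> p" and Y: "Y \<in> borel_measurable borel" "\<And>z. z \<notin> ball 0 1 \<Longrightarrow> Y z = 0"
    and i: "integrable lborel (\<lambda>z. norm (Y z) powr p)"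
  shows "integrable lborel (\<lambda>z. norm (Y z) powr q)"
proof (rule Bochner_Integration.integrable_bound)
  \<comment> \<open>On the ball, which has finite measure, \<open>t powr q \<le> 1 + t powr p\<close>.\<close>
  show "integrable lborel (\<lambda>z. indicator (ball 0 1) z + norm (Y z) powr p)"
    using i emeasure_lborel_ball_finite[of "0 :: real^3" 1] by (intro Bochner_Integration.integrable_add) auto
  show "(\<lambda>z. norm (Y z) powr q) \<in> borel_measurable lborel" using Y(1) by measurable
  show "AE z in lborel. norm (norm (Y z) powr q) \<le> norm (indicator (ball 0 1) z + norm (Y z) powr p)"
  proof (rule AE_I2)
    fix z
    have "norm (Y z) powr q \<le> indicator (ball 0 1) z + norm (Y z) powr p"
    proof (cases "z \<in> ball 0 1")
      case True
      have "norm (Y z) powr q \<le> 1 + norm (Y z) powr p"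
      proof (cases "norm (Y z) \<le> 1")
        case True
        then have "norm (Y z) powr q \<le> 1" using q by (intro powr_le1) auto
        then show ?thesis by (rule order_trans) simp
      next
        case False
        then have "norm (Y z) powr q \<le> norm (Y z) powr p" using q by (intro powr_mono) auto
        then show ?thesis by (rule order_trans) simp
      qed
      then show ?thesis using True by simp
    next
      case False
      then show ?thesis using Y(2)[of z] by simp
    qed
    then show "norm (norm (Y z) powr q) \<le> norm (indicator (ball 0 1) z + norm (Y z) powr p)"
      by simp
  qed
qed

theorem corollary1p2:
  fixes p :: real and X :: "real^3 \<Rightarrow> real^3"
  assumes "3/2 \<le> p"
    and "X \<in> Lp_integer_fluxes p"
  shows "\<forall>\<phi>\<in>test_functions (ball 0 1). distributional_div (ball 0 1) X \<phi> = 0"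
proof
  fix \<phi> :: "real^3 \<Rightarrow> real" assume \<phi>: "\<phi> \<in> test_functions (ball 0 1)"
  have "X \<in> Lp_fields p (ball 0 1)" using assms(2) by (simp add: Lp_integer_fluxes_def)
  then obtain Y N where Y [measurable]: "Y \<in> borel_measurable borel" and N: "N \<in> null_sets lborel"
    and XY: "\<And>z. z \<in> ball 0 1 \<Longrightarrow> z \<notin> N \<Longrightarrow> X z = Y z" and Y0: "\<And>z. z \<notin> ball 0 1 \<Longrightarrow> Y z = 0"
    and Yp: "integrable lborel (\<lambda>z. norm (Y z) powr p)"
    by (rule Lp_fields_borel_representative) blast
  have "integrable lborel (\<lambda>z. norm (Y z) powr 1)"
    using assms(1) by (intro integrable_powr_le[OF _ _ Y Y0 Yp]) auto
  then have Y1: "integrable lborel Y"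
    by (simp add: integrable_norm_iff)
  have "integrable lborel (\<lambda>z. norm (Y z) powr (3/2))"
    using assms(1) by (intro integrable_powr_le[OF _ _ Y Y0 Yp]) auto
  then have Y32: "integrable lborel (\<lambda>z. norm (Y z) * sqrt (norm (Y z)))"
    by (simp add: mult_sqrt_eq_powr)
  have zero: "(\<integral>z. Y z \<bullet> gradient \<phi> z \<partial>lborel) = 0"
    by (rule divergence_free_if_integer_flux[OF Y Y1 Y32 AE_integer_flux[OF assms(2) Y Y1 N XY] \<phi>])
  have [measurable]: "gradient \<phi> \<in> borel_measurable borel"
    using test_function_gradient_continuous[OF \<phi>] by (rule borel_measurable_continuous_onI)
  have "(LINT x:ball 0 1|lebesgue. X x \<bullet> gradient \<phi> x) = (\<integral>z. Y z \<bullet> gradient \<phi> z \<partial>lebesgue)"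
    unfolding set_lebesgue_integral_def
  proof (rule integral_cong_AE)
    have ae: "AE z in lebesgue. indicator (ball 0 1) z *\<^sub>R (X z \<bullet> gradient \<phi> z) = Y z \<bullet> gradient \<phi> z"
    proof (rule AE_completion, rule AE_I'[OF N])
      show "{z \<in> space lborel. indicator (ball 0 1) z *\<^sub>R (X z \<bullet> gradient \<phi> z) \<noteq> Y z \<bullet> gradient \<phi> z} \<subseteq> N"
        using XY Y0 by (force simp: indicator_def)
    qed
    show m: "(\<lambda>z. Y z \<bullet> gradient \<phi> z) \<in> borel_measurable lebesgue"
      by (intro measurable_completion) measurable
    show "AE z in lebesgue. indicator (ball 0 1) z *\<^sub>R (X z \<bullet> gradient \<phi> z) = Y z \<bullet> gradient \<phi> z" by fact
    have "X \<in> borel_measurable (lebesgue_on (ball 0 1))"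
      using \<open>X \<in> Lp_fields p (ball 0 1)\<close> by (simp add: Lp_fields_def)
    moreover have "gradient \<phi> \<in> borel_measurable (lebesgue_on (ball 0 1))"
      by (intro measurable_restrict_space1 measurable_completion) measurable
    ultimately have "(\<lambda>z. X z \<bullet> gradient \<phi> z) \<in> borel_measurable (lebesgue_on (ball 0 1))"
      by measurable
    then show "(\<lambda>z. indicator (ball 0 1) z *\<^sub>R (X z \<bullet> gradient \<phi> z)) \<in> borel_measurable lebesgue"
      by (subst (asm) borel_measurable_restrict_space_iff) auto
  qed
  also have "\<dots> = (\<integral>z. Y z \<bullet> gradient \<phi> z \<partial>lborel)"
    by (rule integral_completion) measurable
  finally show "distributional_div (ball 0 1) X \<phi> = 0"
    by (simp add: distributional_div_def zero)
qed

end
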